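(* For $m\ge1$, $n\ge0$, $k\ge0$, $$\tilde S[m,n,k]=\sum_{\sigma\in\tilde S([n^m],k)}q^{\operatorname{inv}\sigma},$$ where $\tilde S[m,n,k]=h_{n-k}([m-1],[2m-1],\dots,[(k+1)m-1])$.
   Context: $[j]=1+q+\dots+q^{j-1}$ ($[0]=0$); $h_j$ is the complete homogeneous symmetric polynomial of degree $j$ ($h_j=0$ for $j<0$). Let $\zeta_m=e^{2\pi i/m}$, $i^c=\zeta_m^c\mathbf e_i$ for $i\in[n]$ (colors mod $m$), $[n^m]=\{0\}\cup\{i^c:i\in[n],0\le c<m\}$, $zS=\{zs:s\in S\}$. A colored set partition of type $(m,n)$ is a set partition of $[n^m]$ into blocks $S_0,\dots,S_{km}$ with (i) $0\in S_0$ and if some $i^c\in S_0$ then all $i^d\in S_0$; (ii) for each $0\le l<k$, $S_{lm+1},\dots,S_{(l+1)m}$ are distinct and of the form $S,\zeta_mS,\dots,\zeta_m^{m-1}S$. A super set partition is such a partition together with, for each base $i$ whose colors lie in $S_0$, a linear ordering of $\{i^0,\dots,i^{m-1}\}$ of the form $i^c,i^{c+1},\dots,i^{c+m-1}$ (exponents mod $m$) with $c\in\{1,\dots,m-1\}$; orderings for different bases are independent, and the blocks $S_1,\dots,S_{km}$ are unordered. $\tilde S([n^m],k)$ is the set of super set partitions with $km+1$ blocks. With $\operatorname{minb}S=0$ if $0\in S$ and otherwise the least base in $S$, the standard form labels blocks so that (ii) holds, $s_i=\operatorname{minb}S_i$ satisfy $0=s_0<s_m<\dots<s_{km}$, and $s_j^{\,r}\in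 S_j$ for $j\in[km]$ with $r=j\bmod m$. The inversions of a super set partition in standard form are (1) pairs $(i^0,S_l)$ with $i^0\in S_j$, $j<l$, $i\ge s_l$, and (2) pairs $(i^0,i^c)$ with $i^0,i^c\in S_0$ and $i^c$ after $i^0$ in the ordering of base $i$; $\operatorname{inv}$ is their number. *)

theory Defs
  imports Complex_Main "HOL-Library.Disjoint_Sets" "HOL-Library.FuncSet"
    "HOL-Library.Multiset" "HOL-Computational_Algebra.Polynomial"
begin

definition q :: "int poly" where
  "q = [:0, 1:]"

definition qnum :: "nat \<Rightarrow> int poly" where
  "qnum j = (\<Sum>i<j. q ^ i)"

text \<open>The monomials of degree \<open>j\<close> in the entries of \<open>xs\<close> correspond to the multisets
  of \<open>j\<close> positions of \<open>xs\<close>.\<close>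

definition hsym :: "int \<Rightarrow> 'a::comm_semiring_1 list \<Rightarrow> 'a" where
  "hsym j xs = (if j < 0 then 0
     else (\<Sum>M | size M = nat j \<and> set_mset M \<subseteq> {..<length xs}. \<Prod>i\<in>#M. xs ! i))"

definition superS :: "nat \<Rightarrow> nat \<Rightarrow> nat \<Rightarrow> int poly" where
  "superS m n k = hsym (int n - int k) (map (\<lambda>a. qnum (a * m - 1)) [1..<k + 2])"

text \<open>A vector of \<open>\<complex>\<^sup>n\<close> is a function \<open>nat \<Rightarrow> complex\<close> vanishing outside \<open>{1..n}\<close>.\<close>

definition zeta :: "nat \<Rightarrow> complex" where
  "zeta m = exp (2 * of_real pi * \<i> / of_nat m)"

definition zvec :: "nat \<Rightarrow> complex" where
  "zvec = (\<lambda>_. 0)"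

text \<open>\<open>col m i c\<close> is the coloured number \<open>i\<^sup>c\<close>; the exponent \<open>c\<close> may be any natural
  number and matters only modulo \<open>m\<close>.\<close>

definition col :: "nat \<Rightarrow> nat \<Rightarrow> nat \<Rightarrow> (nat \<Rightarrow> complex)" where
  "col m i c = (\<lambda>j. if j = i then zeta m ^ c else 0)"

definition colored_numbers :: "nat \<Rightarrow> nat \<Rightarrow> (nat \<Rightarrow> complex) set" where
  "colored_numbers m n = insert zvec {col m i c |i c. i \<in> {1..n} \<and> c < m}"

definition scale :: "complex \<Rightarrow> (nat \<Rightarrow> complex) set \<Rightarrow> (nat \<Rightarrow> complex) set" where
  "scale z S = (\<lambda>s j. z * s j) ` S"

text \<open>A labelling \<open>S\<^sub>0, \<dots>, S\<^bsub>km\<^esub>\<close> of the blocks of \<open>P\<close> is a list \<open>Bs\<close> with \<open>S\<^sub>j = Bs ! j\<close>.\<close>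

definition block_labelling ::
  "nat \<Rightarrow> nat \<Rightarrow> nat \<Rightarrow> (nat \<Rightarrow> complex) set set \<Rightarrow> (nat \<Rightarrow> complex) set list \<Rightarrow> bool" where
  "block_labelling m n k P Bs \<longleftrightarrow>
     length Bs = k * m + 1 \<and> distinct Bs \<and> set Bs = P \<and>
     zvec \<in> Bs ! 0 \<and>
     (\<forall>i\<in>{1..n}. (\<exists>c<m. col m i c \<in> Bs ! 0) \<longrightarrow> (\<forall>d<m. col m i d \<in> Bs ! 0)) \<and>
     (\<forall>l<k. \<exists>S. \<forall>r<m. Bs ! (l * m + 1 + r) = scale (zeta m ^ r) S)"

definition colored_set_partition ::
  "nat \<Rightarrow> nat \<Rightarrow> (nat \<Rightarrow> complex) set set \<Rightarrow> bool" where
  "colored_set_partition m n P \<longleftrightarrow>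
     partition_on (colored_numbers m n) P \<and> (\<exists>k Bs. block_labelling m n k P Bs)"

definition zero_block :: "(nat \<Rightarrow> complex) set set \<Rightarrow> (nat \<Rightarrow> complex) set" where
  "zero_block P = (THE B. B \<in> P \<and> zvec \<in> B)"

definition zero_bases :: "nat \<Rightarrow> nat \<Rightarrow> (nat \<Rightarrow> complex) set set \<Rightarrow> nat set" where
  "zero_bases m n P = {i \<in> {1..n}. \<forall>c<m. col m i c \<in> zero_block P}"

text \<open>A linear ordering is given as the list of its elements in increasing order.\<close>

definition cyclic_orders :: "nat \<Rightarrow> nat \<Rightarrow> (nat \<Rightarrow> complex) list set" where
  "cyclic_orders m i = {map (col m i) [c..<c + m] |c. c \<in> {1..m - 1}}"

text \<open>A super set partition is a pair of the underlying set of blocks and the family of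
  orderings, the latter extensional so that it carries no data outside the zero block.\<close>

type_synonym super_partition =
  "(nat \<Rightarrow> complex) set set \<times> (nat \<Rightarrow> (nat \<Rightarrow> complex) list)"

definition super_set_partitions :: "nat \<Rightarrow> nat \<Rightarrow> nat \<Rightarrow> super_partition set" where
  "super_set_partitions m n k =
     {(P, w). colored_set_partition m n P \<and> card P = k * m + 1 \<and>
              w \<in> (\<Pi>\<^sub>E i\<in>zero_bases m n P. cyclic_orders m i)}"

definition minb :: "nat \<Rightarrow> (nat \<Rightarrow> complex) set \<Rightarrow> nat" where
  "minb m S = (if zvec \<in> S then 0 else LEAST i. \<exists>c<m. col m i c \<in> S)"

definition is_standard_form ::
  "nat \<Rightarrow> nat \<Rightarrow> nat \<Rightarrow> (nat \<Rightarrow> complex) set set \<Rightarrow> (nat \<Rightarrow> complex) set list \<Rightarrow> bool" where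
  "is_standard_form m n k P Bs \<longleftrightarrow>
     block_labelling m n k P Bs \<and>
     minb m (Bs ! 0) = 0 \<and>
     (\<forall>l<k. minb m (Bs ! (l * m)) < minb m (Bs ! ((l + 1) * m))) \<and>
     (\<forall>j\<in>{1..k * m}. col m (minb m (Bs ! j)) (j mod m) \<in> Bs ! j)"

text \<open>The standard form of a coloured set partition exists and is unique.\<close>

definition standard_form ::
  "nat \<Rightarrow> nat \<Rightarrow> nat \<Rightarrow> (nat \<Rightarrow> complex) set set \<Rightarrow> (nat \<Rightarrow> complex) set list" where
  "standard_form m n k P = (THE Bs. is_standard_form m n k P Bs)"

definition block_inversions ::
  "nat \<Rightarrow> nat \<Rightarrow> nat \<Rightarrow> super_partition \<Rightarrow> ((nat \<Rightarrow> complex) \<times> (nat \<Rightarrow> complex) set) set" where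
  "block_inversions m n k \<sigma> =
     (let Bs = standard_form m n k (fst \<sigma>) in
      {(col m i 0, Bs ! l) |i j l.
         i \<in> {1..n} \<and> j < l \<and> l \<le> k * m \<and> col m i 0 \<in> Bs ! j \<and> minb m (Bs ! l) \<le> i})"

definition order_inversions ::
  "nat \<Rightarrow> nat \<Rightarrow> nat \<Rightarrow> super_partition \<Rightarrow> ((nat \<Rightarrow> complex) \<times> (nat \<Rightarrow> complex)) set" where
  "order_inversions m n k \<sigma> =
     (let S0 = standard_form m n k (fst \<sigma>) ! 0 in
      {(col m i 0, col m i c) |i c.
         i \<in> {1..n} \<and> c < m \<and> col m i 0 \<in> S0 \<and> col m i c \<in> S0 \<and>
         (\<exists>a b. a < b \<and> b < length (snd \<sigma> i) \<and>
                snd \<sigma> i ! a = col m i 0 \<and> snd \<sigma> i ! b = col m i c)})"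

definition inversions :: "nat \<Rightarrow> nat \<Rightarrow> nat \<Rightarrow> super_partition \<Rightarrow> nat" where
  "inversions m n k \<sigma> = card (block_inversions m n k \<sigma>) + card (order_inversions m n k \<sigma>)"

end

theory Submission
  imports Defs
begin

text \<open>In standard form, a coloured set partition is determined by the labels \<open>F i\<close> of the blocks
  containing \<open>i\<^sup>0\<close>, and a sequence \<open>F 1, \<dots>, F n\<close> occurs iff each group of \<open>m\<close> labels is opened, in
  increasing order, by its last label. If \<open>K\<close> groups have been opened up to and including base \<open>i\<close>,
  then \<open>i\<^sup>0\<close> accounts for \<open>K m - F i\<close> inversions with blocks and, if \<open>F i = 0\<close> and the ordering of base
  \<open>i\<close> starts with \<open>i\<^sup>c\<close>, for \<open>c - 1\<close> further ones. Hence base \<open>n\<close> contributes the factor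
  \<open>[k m] + q\<^bsup>k m\<^esup> [m - 1] = [(k + 1) m - 1]\<close> if it opens no group and \<open>1\<close> if it opens the last one, which
  is the recurrence
  \<open>h\<^bsub>n - k\<^esub>(x\<^sub>1, \<dots>, x\<^bsub>k + 1\<^esub>) = h\<^bsub>n - k\<^esub>(x\<^sub>1, \<dots>, x\<^sub>k) + x\<^bsub>k + 1\<^esub> h\<^bsub>n - k - 1\<^esub>(x\<^sub>1, \<dots>, x\<^bsub>k + 1\<^esub>)\<close>.\<close>

subsection \<open>The recurrence for complete homogeneous symmetric polynomials\<close>

lemma finite_multisets_size: "finite {M. size M = N \<and> set_mset M \<subseteq> {..<L::nat}}"
proof -
  have "{M. size M = N \<and> set_mset M \<subseteq> {..<L}} \<subseteq> mset ` {xs. set xs \<subseteq> {..<L} \<and> length xs = N}"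
  proof
    fix M assume M: "M \<in> {M. size M = N \<and> set_mset M \<subseteq> {..<L}}"
    obtain xs where "M = mset xs" by (metis ex_mset)
    with M show "M \<in> mset ` {xs. set xs \<subseteq> {..<L} \<and> length xs = N}" by auto
  qed
  then show ?thesis by (rule finite_subset) (simp add: finite_lists_length_eq)
qed

lemma hsym_neg: "j < 0 \<Longrightarrow> hsym j xs = 0"
  by (simp add: hsym_def)

lemma hsym_0: "hsym 0 xs = 1"
proof -
  have "{M. size M = 0 \<and> set_mset M \<subseteq> {..<length xs}} = {{#}}" by auto
  then show ?thesis by (simp add: hsym_def)
qed

lemma hsym_Nil: "j > 0 \<Longrightarrow> hsym j [] = 0"
proof -
  assume "j > 0"
  then have "{M::nat multiset. size M = nat j \<and> set_mset M \<subseteq> {..<length []}} = {}" by auto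
  then show ?thesis unfolding hsym_def by (metis sum.empty)
qed

text \<open>A multiset of positions either avoids the last position or contains it. In the second
  case removing one copy leaves an arbitrary multiset of size one less, in which the last position
  may still occur.\<close>

lemma hsym_snoc: "hsym j (xs @ [x]) = hsym j xs + x * hsym (j - 1) (xs @ [x])"
proof (cases "j \<le> 0")
  case True
  \<comment> \<open>In degree 0 both sides are 1, because the second summand has degree -1; in
    negative degree everything vanishes.\<close>
  then show ?thesis by (cases "j = 0") (simp_all add: hsym_neg hsym_0)
next
  case False
  define L where "L = length xs"
  define N where "N = nat (j - 1)"
  have nj: "nat j = Suc N" using False by (simp add: N_def)
  let ?A = "{M. size M = Suc N \<and> set_mset M \<subseteq> {..<L}}"
  let ?B = "{M. size M = N \<and> set_mset M \<subseteq> {..<Suc L}}"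
  let ?f = "\<lambda>M. \<Prod>i\<in>#M. (xs @ [x]) ! i"
  have split: "{M. size M = Suc N \<and> set_mset M \<subseteq> {..<Suc L}} = ?A \<union> add_mset L ` ?B" (is "?C = _")
  proof (intro set_eqI iffI)
    fix M assume M: "M \<in> ?C"
    show "M \<in> ?A \<union> add_mset L ` ?B"
    proof (cases "L \<in># M")
      case True
      then obtain M' where "M = add_mset L M'" by (metis mset_add)
      with M show ?thesis by auto
    next
      case False
      then have "set_mset M \<subseteq> {..<L}" using M less_Suc_eq by auto
      with M show ?thesis by auto
    qed
  qed auto
  have "hsym j (xs @ [x]) = sum ?f (?A \<union> add_mset L ` ?B)"
    using False by (simp add: hsym_def nj split flip: L_def)
  also have "\<dots> = sum ?f ?A + sum ?f (add_mset L ` ?B)"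
    by (rule sum.union_disjoint) (auto simp: finite_multisets_size)
  also have "sum ?f ?A = hsym j xs"
  proof -
    have "?f M = (\<Prod>i\<in>#M. xs ! i)" if "M \<in> ?A" for M
    proof -
      have "image_mset ((!) (xs @ [x])) M = image_mset ((!) xs) M"
        by (rule image_mset_cong) (use that in \<open>auto simp: nth_append L_def subset_eq\<close>)
      then show ?thesis by simp
    qed
    then show ?thesis using False by (simp add: hsym_def nj flip: L_def)
  qed
  also have "sum ?f (add_mset L ` ?B) = x * hsym (j - 1) (xs @ [x])"
    using False
    by (subst sum.reindex)
       (auto simp: hsym_def inj_on_def sum_distrib_left L_def nth_append N_def intro!: sum.cong)
  finally show ?thesis .
qed

lemma superS_0: "superS m 0 k = (if k = 0 then 1 else 0)"
  by (simp add: superS_def hsym_0 hsym_neg)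

text \<open>Split off the last entry with \<open>hsym_snoc\<close>. The remaining \<open>k\<close>
  entries in degree \<open>n + 1 - k\<close> are those of \<open>superS m n (k - 1)\<close>; for
  \<open>k = 0\<close> the list is empty while the degree is positive, which gives 0.\<close>

lemma superS_Suc:
  "superS m (Suc n) k =
     qnum (Suc k * m - 1) * superS m n k + (if k = 0 then 0 else superS m n (k - 1))"
proof -
  define xs where "xs = map (\<lambda>a. qnum (a * m - 1)) [1..<k + 1]"
  have xs: "map (\<lambda>a. qnum (a * m - 1)) [1..<k + 2] = xs @ [qnum (Suc k * m - 1)]"
    by (simp add: xs_def)
  have "superS m (Suc n) k = hsym (int (Suc n) - int k) xs + qnum (Suc k * m - 1) * superS m n k"
    unfolding superS_def xs by (subst hsym_snoc) (simp add: algebra_simps)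
  moreover have "hsym (int (Suc n) - int k) xs = (if k = 0 then 0 else superS m n (k - 1))"
    by (cases k) (simp_all add: xs_def hsym_Nil superS_def)
  ultimately show ?thesis by simp
qed

subsection \<open>Growth words\<close>

text \<open>Counts the groups of \<open>m\<close> labels opened by the bases up to \<open>i\<close>.
  After \<open>p\<close> groups the labels in use end at \<open>p * m\<close>, so a letter beyond
  that starts a new group.\<close>

primrec opened :: "nat \<Rightarrow> (nat \<Rightarrow> int) \<Rightarrow> nat \<Rightarrow> nat" where
  "opened m a 0 = 0"
| "opened m a (Suc i) =
     (if a (Suc i) > int (opened m a i * m) then Suc (opened m a i) else opened m a i)"

text \<open>A growth word records for each base \<open>i\<close> the label \<open>a i\<close> of the block containing \<open>i\<^sup>0\<close> if
  that block is not the zero block; otherwise \<open>a i = 1 - c\<close>, where the ordering of base \<open>i\<close> starts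
  with \<open>i\<^sup>c\<close>. With this shift \<open>i\<close> contributes \<open>opened m a i * m - a i\<close> inversions in both cases.\<close>

definition growth_words :: "nat \<Rightarrow> nat \<Rightarrow> nat \<Rightarrow> (nat \<Rightarrow> int) set" where
  "growth_words m n k =
     {a \<in> extensional {1..n}. opened m a n = k \<and>
        (\<forall>i<n. 2 - int m \<le> a (Suc i) \<and>
           (a (Suc i) \<le> int (opened m a i * m) \<or> a (Suc i) = int (Suc (opened m a i) * m)))}"

definition weight :: "nat \<Rightarrow> nat \<Rightarrow> (nat \<Rightarrow> int) \<Rightarrow> nat" where
  "weight m n a = (\<Sum>i=1..n. nat (int (opened m a i * m) - a i))"

lemma opened_cong: "(\<And>j. j \<in> {1..i} \<Longrightarrow> a j = b j) \<Longrightarrow> opened m a i = opened m b i"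
  by (induction i) auto

lemma opened_upd [simp]: "i \<le> n \<Longrightarrow> opened m (a(Suc n := x)) i = opened m a i"
  by (rule opened_cong) auto

lemma weight_upd:
  "weight m (Suc n) (a(Suc n := x)) =
     weight m n a + nat (int (opened m (a(Suc n := x)) (Suc n) * m) - x)"
proof -
  have "(\<Sum>i=1..n. nat (int (opened m (a(Suc n := x)) i * m) - (a(Suc n := x)) i)) = weight m n a"
    unfolding weight_def by (rule sum.cong) auto
  then show ?thesis by (simp add: weight_def del: opened.simps)
qed

lemma extensional_upd: "a \<in> extensional {Suc 0..n} \<Longrightarrow> a(Suc n := x) \<in> extensional {Suc 0..Suc n}"
  by (auto simp: extensional_def)

lemma growth_words_0: "growth_words m 0 k = (if k = 0 then {\<lambda>_. undefined} else {})"
  by (auto simp: growth_words_def)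

text \<open>Case distinction on whether base \<open>n + 1\<close> opens a group. If not, its letter
  is free in the whole range up to \<open>k * m\<close>; if so, the letter is forced to be
  \<open>k * m\<close>.\<close>

lemma growth_words_Suc:
  assumes "m > 0"
  shows "growth_words m (Suc n) k =
     (\<lambda>(x, a). a(Suc n := x)) ` ({2 - int m..int (k * m)} \<times> growth_words m n k) \<union>
     (\<lambda>a. a(Suc n := int (k * m))) ` (if k = 0 then {} else growth_words m n (k - 1))"
    (is "?W = ?A \<union> ?B")
proof (intro set_eqI iffI)
  fix a assume a: "a \<in> ?W"
  \<comment> \<open>Resetting the last letter keeps the shorter word extensional on
    \<open>{1..n}\<close>.\<close>
  define b where "b = a(Suc n := undefined)"
  have ab: "a = b(Suc n := a (Suc n))" by (simp add: b_def)
  have b: "b \<in> growth_words m n (opened m a n)"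
    using a by (auto simp: growth_words_def b_def extensional_def)
  show "a \<in> ?A \<union> ?B"
  proof (cases "opened m a n = k")
    case True
    then have "a (Suc n) \<in> {2 - int m..int (k * m)}"
      using a assms by (auto simp: growth_words_def split: if_splits)
    then show ?thesis using b ab True by (auto intro!: image_eqI[where x = "(a (Suc n), b)"])
  next
    case False
    then have "k = Suc (opened m a n) \<and> a (Suc n) = int (k * m)"
      using a by (auto simp: growth_words_def distrib_right split: if_splits)
    then have k: "k = Suc (opened m a n)" and x: "a (Suc n) = int (k * m)"
      by blast+
    then have "k > 0" "opened m a n = k - 1" by simp_all
    moreover have "a = b(Suc n := int (k * m))" using ab unfolding x .
    ultimately show ?thesis using b by auto
  qed
next
  fix a assume "a \<in> ?A \<union> ?B"
  then show "a \<in> ?W"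
  proof
    assume "a \<in> ?A"
    then obtain x b where "a = b(Suc n := x)" "x \<in> {2 - int m..int (k * m)}" "b \<in> growth_words m n k"
      by auto
    then show ?thesis
      by (auto simp: growth_words_def less_Suc_eq intro: extensional_upd)
  next
    assume "a \<in> ?B"
    then obtain b k' where k: "k = Suc k'" and b: "a = b(Suc n := int (k * m))" "b \<in> growth_words m n k'"
      by (cases k) auto
    have "2 - int m \<le> int k * int m"
      using assms unfolding k of_nat_Suc distrib_right by (simp add: add_increasing2 flip: of_nat_mult)
    have opened: "opened m b n = k'" using b by (simp add: growth_words_def)
    have "2 - int m \<le> a (Suc i) \<and>
        (a (Suc i) \<le> int (opened m a i * m) \<or> a (Suc i) = int (Suc (opened m a i) * m))"
      if "i < Suc n" for i
    proof (cases "i = n")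
      case True
      have "Suc (opened m b n) = k" using opened k by simp
      moreover have "2 - int m \<le> int (k * m)" using \<open>2 - int m \<le> int k * int m\<close> by simp
      ultimately show ?thesis unfolding True b(1) by (simp del: of_nat_mult mult_Suc of_nat_Suc)
    next
      case False
      then show ?thesis using that b by (simp add: growth_words_def)
    qed
    moreover have "opened m a (Suc n) = k"
      using assms b(1) opened k by simp
    moreover have "a \<in> extensional {1..Suc n}"
      using b by (simp add: growth_words_def extensional_upd)
    ultimately show ?thesis by (simp add: growth_words_def del: opened.simps)
  qed
qed

section \<open>Generating function of growth words by weight\<close>

lemma finite_growth_words: "m > 0 \<Longrightarrow> finite (growth_words m n k)"
  by (induction n arbitrary: k) (simp_all add: growth_words_0 growth_words_Suc)

text \<open>By extensionality the shorter word is \<open>undefined\<close> at \<open>n + 1\<close>,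
  so the updated word determines both the new letter and the old word.\<close>

lemma inj_on_upd: "inj_on (\<lambda>(x, a). a(Suc n := x)) (X \<times> growth_words m n k)"
proof (rule inj_onI, clarify)
  fix x a y b
  assume "a \<in> growth_words m n k" "b \<in> growth_words m n k" and eq: "a(Suc n := x) = b(Suc n := y)"
  then have "a (Suc n) = undefined" "b (Suc n) = undefined"
    by (auto simp: growth_words_def extensional_def)
  with eq show "x = y \<and> a = b" by (metis fun_upd_same fun_upd_triv fun_upd_upd)
qed

text \<open>The exponents \<open>N - x\<close> run through \<open>0, ..., m + N - 2\<close>. With
  \<open>N = k * m\<close> this is the factor of a base that opens no group, covering the nonzero
  blocks and the orderings at once.\<close>

lemma sum_powers_qnum:
  assumes "m > 0"
  shows "(\<Sum>x\<in>{2 - int m..int N}. q ^ nat (int N - x)) = qnum (m + N - 1)"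
  unfolding qnum_def
  by (rule sum.reindex_bij_witness[where i = "\<lambda>i. int N - int i" and j = "\<lambda>x. nat (int N - x)"])
     (use assms in auto)

lemma superS_growth_words:
  assumes m: "m > 0"
  shows "superS m n k = (\<Sum>a\<in>growth_words m n k. q ^ weight m n a)"
proof (induction n arbitrary: k)
  case 0
  then show ?case by (simp add: superS_0 growth_words_0 weight_def)
next
  case (Suc n)
  let ?X = "{2 - int m..int (k * m)}"
  let ?W' = "if k = 0 then {} else growth_words m n (k - 1)"
  let ?f = "\<lambda>(x, a). a(Suc n := x)" and ?g = "\<lambda>a. a(Suc n := int (k * m))"
  let ?A = "?f ` (?X \<times> growth_words m n k)" and ?B = "?g ` ?W'"
  \<comment> \<open>The two kinds of words are told apart by the number of groups opened by the
    first \<open>n\<close> letters.\<close>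
  have "a \<noteq> b" if "a \<in> ?A" "b \<in> ?B" for a b
  proof -
    have "opened m a n = k" using that(1) by (auto simp: growth_words_def)
    moreover have "opened m b n \<noteq> k" using that(2) by (auto simp: growth_words_def split: if_splits)
    ultimately show ?thesis by auto
  qed
  then have disj: "?A \<inter> ?B = {}" by blast
  have inj: "inj_on ?g ?W'"
    using inj_on_upd[of n "{int (k * m)}" m "k - 1"] by (auto simp: inj_on_def)
  have wA: "weight m (Suc n) (a(Suc n := x)) = weight m n a + nat (int (k * m) - x)"
    if "x \<in> ?X" "a \<in> growth_words m n k" for x a
    using that by (subst weight_upd) (auto simp: growth_words_def)
  \<comment> \<open>An opening letter is the largest label opened so far, so it adds no
    weight.\<close>
  have wB: "weight m (Suc n) (?g a) = weight m n a" if "a \<in> ?W'" for a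
  proof -
    have "k > 0" "opened m a n = k - 1" using that by (auto simp: growth_words_def split: if_splits)
    then show ?thesis using m by (subst weight_upd) simp
  qed
  have "(\<Sum>a\<in>growth_words m (Suc n) k. q ^ weight m (Suc n) a)
      = (\<Sum>a\<in>?A. q ^ weight m (Suc n) a) + (\<Sum>a\<in>?B. q ^ weight m (Suc n) a)"
    unfolding growth_words_Suc[OF m]
    by (rule sum.union_disjoint) (use disj m in \<open>auto simp: finite_growth_words\<close>)
  also have "(\<Sum>a\<in>?A. q ^ weight m (Suc n) a) =
      (\<Sum>(x, a)\<in>?X \<times> growth_words m n k. q ^ nat (int (k * m) - x) * q ^ weight m n a)"
    by (subst sum.reindex[OF inj_on_upd])
       (auto simp: wA power_add mult.commute intro!: sum.cong)
  also have "\<dots> = qnum (Suc k * m - 1) * superS m n k"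
    by (simp add: sum.cartesian_product[symmetric] sum_product[symmetric] sum_powers_qnum[OF m] Suc[symmetric]
        del: of_nat_mult)
  also have "(\<Sum>a\<in>?B. q ^ weight m (Suc n) a) = (\<Sum>a\<in>?W'. q ^ weight m n a)"
    unfolding sum.reindex[OF inj] o_def by (rule sum.cong) (simp_all only: wB)
  also have "\<dots> = (if k = 0 then 0 else superS m n (k - 1))" by (simp add: Suc)
  finally show ?case by (simp add: superS_Suc)
qed

section \<open>Growth words described by the positions that open groups\<close>

text \<open>\<open>s l\<close> is the position at which the \<open>(l + 1)\<close>-st group is opened.\<close>

definition openings :: "nat \<Rightarrow> nat \<Rightarrow> nat \<Rightarrow> (nat \<Rightarrow> int) \<Rightarrow> (nat \<Rightarrow> nat) \<Rightarrow> bool" where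
  "openings m n k a s \<longleftrightarrow>
     strict_mono_on {..<k} s \<and> (\<forall>l<k. s l \<in> {1..n} \<and> a (s l) = int (Suc l * m)) \<and>
     (\<forall>i\<in>{1..n}. 2 - int m \<le> a i \<and> a i \<le> int (k * m) \<and> (\<forall>l<k. int (l * m) < a i \<longrightarrow> s l \<le> i))"

text \<open>Induction on \<open>i\<close> with \<open>p\<close> groups open: a letter beyond
  \<open>p * m\<close> forces \<open>s p \<le> i + 1\<close>, hence \<open>s p = i + 1\<close>;
  conversely, a position \<open>s l\<close> with \<open>l \<ge> p\<close> carries a letter beyond
  \<open>p * m\<close>.\<close>

lemma openings_opened:
  assumes "m > 0" and s: "openings m n k a s" and "i \<le> n"
  shows "opened m a i \<le> k \<and> (\<forall>l<k. s l \<le> i \<longleftrightarrow> l < opened m a i)"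
  using \<open>i \<le> n\<close>
proof (induction i)
  case 0
  then show ?case using s by (fastforce simp: openings_def)
next
  case (Suc i)
  define p where "p = opened m a i"
  have IH: "p \<le> k" "\<And>l. l < k \<Longrightarrow> s l \<le> i \<longleftrightarrow> l < p" using Suc by (auto simp: p_def)
  have op: "opened m a (Suc i) = (if a (Suc i) > int (p * m) then Suc p else p)"
    by (simp add: p_def)
  have i: "Suc i \<in> {1..n}" using Suc by simp
  \<comment> \<open>No second group opens at the same position: \<open>p < l\<close> would give
    \<open>s p < s l = i + 1\<close>, although group \<open>p\<close> is not open at
    \<open>i\<close>.\<close>
  have sl: "l = p" if "l < k" "s l = Suc i" "int (p * m) < a (Suc i)" for l
  proof -
    have "\<not> l < p" using IH(2)[of l] that by simp
    moreover have "p < k" using that \<open>\<not> l < p\<close> by simp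
    moreover have "s p \<le> Suc i" using s i that \<open>p < k\<close> unfolding openings_def by blast
    moreover have "s p < s l" if "p < l"
      using s \<open>l < k\<close> \<open>p < k\<close> that strict_mono_onD[of "{..<k}" s p l] unfolding openings_def by auto
    moreover have "\<not> s p \<le> i" using IH(2)[of p] \<open>p < k\<close> by simp
    ultimately show ?thesis using that(2) by fastforce
  qed
  show ?case
  proof (cases "a (Suc i) > int (p * m)")
    case True
    have "a (Suc i) \<le> int (k * m)" using s i unfolding openings_def by blast
    then have "int (p * m) < int (k * m)" using True by linarith
    then have "p * m < k * m" unfolding of_nat_less_iff .
    then have pk: "p < k" by simp
    then have "s p \<le> Suc i" using s i True unfolding openings_def by blast
    then have sp: "s p = Suc i" using IH(2)[OF pk] by simp
    have "s l \<le> Suc i \<longleftrightarrow> l < Suc p" if "l < k" for l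
      using IH(2)[OF that] sl[OF that] sp True by (auto simp: le_Suc_eq less_Suc_eq)
    then show ?thesis using pk True unfolding op by simp
  next
    case False
    have "s l \<noteq> Suc i" if "l < k" "\<not> l < p" for l
    proof
      assume "s l = Suc i"
      then have "a (Suc i) = int (Suc l * m)" using s that unfolding openings_def by metis
      moreover have "p * m < Suc l * m" using that assms(1) by (intro mult_less_mono1) auto
      then have "int (p * m) < int (Suc l * m)" unfolding of_nat_less_iff .
      ultimately show False using False by (simp only: p_def not_True_eq_False)
    qed
    then have "s l \<le> Suc i \<longleftrightarrow> l < p" if "l < k" for l
      using IH(2)[OF that] that by (auto simp: le_Suc_eq)
    then show ?thesis using IH(1) False unfolding op by simp
  qed
qed

lemma opened_mono: "i \<le> j \<Longrightarrow> opened m a i \<le> opened m a j"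
  by (rule lift_Suc_mono_le[of "opened m a"]) auto

text \<open>Passes from the step-by-step description, which yields the recurrence, to a global one
  that can be compared with standard forms, where \<open>s l\<close> becomes the least base of group
  \<open>l\<close>.\<close>

lemma growth_words_iff:
  assumes m: "m > 0"
  shows "a \<in> growth_words m n k \<longleftrightarrow> a \<in> extensional {1..n} \<and> (\<exists>s. openings m n k a s)"
proof safe
  assume a: "a \<in> growth_words m n k"
  then show "a \<in> extensional {1..n}" by (simp add: growth_words_def)
  have k: "opened m a n = k" using a by (simp add: growth_words_def)
  have step: "2 - int m \<le> a (Suc i)"
      "a (Suc i) \<le> int (opened m a i * m) \<or> a (Suc i) = int (Suc (opened m a i) * m)"
    if "i < n" for i using a that by (auto simp: growth_words_def)
  have le: "a i \<le> int (opened m a i * m)" if "i \<in> {1..n}" for i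
    using that step(2)[of "i - 1"] m by (cases i) (auto simp: distrib_right)
  define s where "s l = (LEAST i. l < opened m a i)" for l
  have s: "l < opened m a (s l)" "\<And>i. l < opened m a i \<Longrightarrow> s l \<le> i" "s l \<le> n" if "l < k" for l
    using that LeastI[of "\<lambda>i. l < opened m a i" n] Least_le[of "\<lambda>i. l < opened m a i"] k
    by (auto simp: s_def)
  \<comment> \<open>At the first position where the count exceeds \<open>l\<close> it jumps from
    \<open>l\<close> to \<open>l + 1\<close>, and the growth condition then leaves only one possible
    letter.\<close>
  have s': "s l > 0" "opened m a (s l - 1) = l" "opened m a (s l) = Suc l" "a (s l) = int (Suc l * m)"
    if "l < k" for l
  proof -
    show "s l > 0" using s(1)[OF that] by (cases "s l") auto
    then obtain i where i: "s l = Suc i" by (cases "s l") auto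
    have "\<not> l < opened m a i" using s(2)[OF that, of i] i by auto
    moreover have "i < n" using s(3)[OF that] i by simp
    ultimately show "opened m a (s l - 1) = l" "opened m a (s l) = Suc l" "a (s l) = int (Suc l * m)"
      using s(1)[OF that] step(2)[of i] by (auto simp: i split: if_splits)
  qed
  have "openings m n k a s"
    unfolding openings_def
  proof (intro conjI ballI allI impI)
    show "strict_mono_on {..<k} s"
    proof (rule strict_mono_onI)
      fix l l' assume "l \<in> {..<k}" "l' \<in> {..<k}" "l < l'"
      then show "s l < s l'" using s'(3)[of l] s'(3)[of l'] opened_mono[of "s l'" "s l" m a] by (auto simp: not_less[symmetric])
    qed
    fix i assume i: "i \<in> {1..n}"
    show "2 - int m \<le> a i" using step(1)[of "i - 1"] i by auto
    have "opened m a i \<le> k" using opened_mono[of i n m a] i k by simp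
    then have "opened m a i * m \<le> k * m" by simp
    then show "a i \<le> int (k * m)" using le[OF i] by linarith
    fix l assume l: "l < k" "int (l * m) < a i"
    then have "int (l * m) < int (opened m a i * m)" using le[OF i] by linarith
    then have "l * m < opened m a i * m" unfolding of_nat_less_iff .
    then show "s l \<le> i" using s(2)[OF l(1)] by simp
  qed (use s s' in \<open>auto simp: Suc_le_eq\<close>)
  then show "\<exists>s. openings m n k a s" by blast
next
  fix s assume ext: "a \<in> extensional {1..n}" and s: "openings m n k a s"
  note op = openings_opened[OF m s]
  \<comment> \<open>If only \<open>p < k\<close> groups were open at \<open>n\<close>, then
    \<open>s p \<le> n\<close> would mean \<open>p < p\<close>.\<close>
  have kn: "opened m a n = k"
  proof (rule ccontr)
    assume "opened m a n \<noteq> k"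
    then have "opened m a n < k" using op[of n] by simp
    then show False using op[of n] s by (auto simp: openings_def)
  qed
  have "2 - int m \<le> a (Suc i) \<and>
           (a (Suc i) \<le> int (opened m a i * m) \<or> a (Suc i) = int (Suc (opened m a i) * m))"
    if i: "i < n" for i
  proof (rule conjI)
    have "Suc i \<in> {1..n}" using i by simp
    then show "2 - int m \<le> a (Suc i)" using s unfolding openings_def by blast
    show "a (Suc i) \<le> int (opened m a i * m) \<or> a (Suc i) = int (Suc (opened m a i) * m)"
    proof (cases "a (Suc i) \<le> int (opened m a i * m)")
      case True
      then show ?thesis ..
    next
      case False
      \<comment> \<open>The count rises from \<open>p\<close> to \<open>p + 1\<close> at
        \<open>i + 1\<close>, so group \<open>p\<close> opens exactly there and its letter is
        prescribed by \<open>openings\<close>.\<close>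
      define p where "p = opened m a i"
      have "Suc p \<le> k" using op[of "Suc i"] False i by (simp add: p_def)
      then have "p < k" by simp
      moreover have "\<not> s p \<le> i" using op[of i] i \<open>p < k\<close> by (simp add: p_def)
      moreover have "s p \<le> Suc i" using op[of "Suc i"] i False \<open>p < k\<close> by (auto simp: p_def)
      ultimately have "s p = Suc i" by simp
      then have "a (Suc i) = int (Suc p * m)" using s \<open>p < k\<close> unfolding openings_def by metis
      then show ?thesis by (simp add: p_def)
    qed
  qed
  then show "a \<in> growth_words m n k" using ext kn by (simp add: growth_words_def)
qed

subsection \<open>Coloured numbers and blocks\<close>

lemma div_mod_eq_iff:
  fixes u v l r m :: nat
  assumes "v < m" "r < m"
  shows "u * m + v = l * m + r \<longleftrightarrow> u = l \<and> v = r"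
proof
  assume eq: "u * m + v = l * m + r"
  have "(u * m + v) div m = u" "(u * m + v) mod m = v" "(l * m + r) div m = l" "(l * m + r) mod m = r"
    using assms by simp_all
  with eq show "u = l \<and> v = r" by metis
qed simp

text \<open>The label of the block containing \<open>i\<^sup>c\<close>, where \<open>x = a i\<close>: raising the colour by \<open>c\<close> rotates
  the label of the block of \<open>i\<^sup>0\<close> by \<open>c\<close> within its group of \<open>m\<close> labels.\<close>

definition block_index :: "nat \<Rightarrow> int \<Rightarrow> nat \<Rightarrow> nat" where
  "block_index m x c =
     (if x \<le> 0 then 0 else (nat x - 1) div m * m + 1 + (nat x - 1 + c) mod m)"

text \<open>The intended block with label \<open>j\<close> in standard form. The zero vector has no
  letter and is placed in block 0 separately.\<close>

definition blk :: "nat \<Rightarrow> nat \<Rightarrow> (nat \<Rightarrow> int) \<Rightarrow> nat \<Rightarrow> (nat \<Rightarrow> complex) set" where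
  "blk m n a j =
     {col m i c |i c. i \<in> {1..n} \<and> c < m \<and> block_index m (a i) c = j} \<union>
     (if j = 0 then {zvec} else {})"

text \<open>The starting exponent \<open>1 - a i\<close> undoes the shift in the letters of zero
  bases. The value \<open>undefined\<close> elsewhere makes the family extensional, as
  \<open>super_set_partitions\<close> demands.\<close>

definition of_word :: "nat \<Rightarrow> nat \<Rightarrow> nat \<Rightarrow> (nat \<Rightarrow> int) \<Rightarrow> super_partition" where
  "of_word m n k a =
     (blk m n a ` {..k * m},
      \<lambda>i. if i \<in> {1..n} \<and> a i \<le> 0 then map (col m i) [nat (1 - a i)..<nat (1 - a i) + m]
          else undefined)"

lemma block_index_mod [simp]: "block_index m x (c mod m) = block_index m x c"
  by (simp only: block_index_def mod_add_right_eq)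

lemma partition_on_block_eq:
  "partition_on A P \<Longrightarrow> p \<in> P \<Longrightarrow> p' \<in> P \<Longrightarrow> x \<in> p \<Longrightarrow> x \<in> p' \<Longrightarrow> p = p'"
  unfolding partition_on_def disjoint_def by blast

section \<open>Roots of unity and the rotation of colours\<close>

locale modulus =
  fixes m :: nat
  assumes m_pos: "m > 0"
begin

lemma zeta_power: "zeta m ^ c = cis (2 * pi * real c / real m)"
proof -
  have "zeta m = cis (2 * pi / real m)"
    by (simp add: zeta_def cis_conv_exp mult_ac)
  then show ?thesis by (simp add: DeMoivre mult_ac)
qed

lemma zeta_nonzero [simp]: "zeta m \<noteq> 0"
  by (simp add: zeta_def)

lemma zeta_power_m: "zeta m ^ m = 1"
  using m_pos by (simp add: zeta_power)

lemma zeta_power_mod: "zeta m ^ (c mod m) = zeta m ^ c"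
proof -
  have "zeta m ^ c = zeta m ^ (c div m * m + c mod m)" by simp
  also have "\<dots> = (zeta m ^ m) ^ (c div m) * zeta m ^ (c mod m)"
    by (simp only: power_add power_mult mult.commute)
  finally show ?thesis by (simp add: zeta_power_m)
qed

text \<open>This says that \<open>zeta m\<close> is a primitive root: the powers below
  \<open>m\<close> are the distinct \<open>m\<close>-th roots of unity.\<close>

lemma zeta_power_eq_iff: "zeta m ^ c = zeta m ^ d \<longleftrightarrow> c mod m = d mod m"
proof
  assume eq: "zeta m ^ c = zeta m ^ d"
  have "inj_on (\<lambda>c. cis (2 * pi * real c / real m)) {..<m}"
    using bij_betw_roots_unity[OF m_pos] by (rule bij_betw_imp_inj_on)
  then have "inj_on ((^) (zeta m)) {..<m}" by (simp only: inj_on_def zeta_power)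
  moreover have "zeta m ^ (c mod m) = zeta m ^ (d mod m)"
    using eq by (simp add: zeta_power_mod)
  ultimately show "c mod m = d mod m" using m_pos by (auto dest: inj_onD)
qed (metis zeta_power_mod)

lemma col_eq_iff: "col m i c = col m j d \<longleftrightarrow> i = j \<and> c mod m = d mod m"
  by (auto simp: col_def fun_eq_iff zeta_power_eq_iff split: if_splits)

lemma col_mod: "col m i (c mod m) = col m i c"
  by (simp add: col_eq_iff)

lemma col_neq_zvec [simp]: "col m i c \<noteq> zvec" "zvec \<noteq> col m i c"
  by (auto simp: col_def zvec_def fun_eq_iff)

lemma Ex_col_iff: "(\<exists>c<m. col m i c \<in> S) \<longleftrightarrow> (\<exists>c. col m i c \<in> S)"
  using m_pos by (metis col_mod mod_less_divisor)

lemma scale_scale: "scale z (scale w S) = scale (z * w) S"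
  by (auto simp: scale_def image_image mult.assoc)

lemma scale_zeta_mod: "scale (zeta m ^ (d mod m)) S = scale (zeta m ^ d) S"
  by (simp add: zeta_power_mod)

lemma zeta_col: "(\<lambda>j. zeta m ^ d * col m i c j) = col m i (c + d)"
  by (auto simp: col_def power_add)

lemma zeta_zvec: "(\<lambda>j. z * zvec j) = zvec"
  by (simp add: zvec_def)

lemma scale_inj: "z \<noteq> 0 \<Longrightarrow> (\<lambda>j. z * x j) \<in> scale z S \<longleftrightarrow> x \<in> S"
  unfolding scale_def by (subst inj_image_mem_iff) (auto simp: inj_def fun_eq_iff)

lemma col_in_scale: "col m i (c + d) \<in> scale (zeta m ^ d) S \<longleftrightarrow> col m i c \<in> S"
  using scale_inj[of "zeta m ^ d" "col m i c" S] by (simp add: zeta_col)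

lemma zvec_in_scale: "zvec \<in> scale (zeta m ^ d) S \<longleftrightarrow> zvec \<in> S"
  using scale_inj[of "zeta m ^ d" zvec S] by (simp add: zeta_zvec)

text \<open>Natural numbers have no negatives, so \<open>d * (m - 1)\<close> serves as
  \<open>-d\<close> modulo \<open>m\<close>; it is used below wherever a rotation is undone.\<close>

lemma mod_shift: "(c + d * (m - 1) + d) mod m = c mod m"
proof -
  have "c + d * (m - 1) + d = c + d * m" using m_pos by (cases m) auto
  then show ?thesis by (simp only: mod_mult_self1)
qed

lemma mod_shift_left: "(c + (c' + c * (m - 1))) mod m = c' mod m"
  using mod_shift[of c' c] by (simp only: add_ac)

lemma Ex_col_in_scale: "(\<exists>c. col m i c \<in> scale (zeta m ^ d) S) \<longleftrightarrow> (\<exists>c. col m i c \<in> S)"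
proof safe
  fix c assume "col m i c \<in> scale (zeta m ^ d) S"
  moreover have "col m i c = col m i (c + d * (m - 1) + d)" by (simp only: col_eq_iff mod_shift)
  ultimately show "\<exists>c. col m i c \<in> S" by (metis col_in_scale)
qed (metis col_in_scale)

lemma minb_scale: "minb m (scale (zeta m ^ d) S) = minb m S"
  by (simp add: minb_def zvec_in_scale Ex_col_iff Ex_col_in_scale)

section \<open>Arithmetic of labels and the blocks of a word\<close>

lemma block_index_0 [simp]: "block_index m x 0 = nat x"
  using div_mult_mod_eq[of "nat x - 1" m] by (auto simp: block_index_def)

lemma block_index_eq_0_iff: "block_index m x c = 0 \<longleftrightarrow> x \<le> 0"
  by (simp add: block_index_def)

lemma block_index_iff:
  "r < m \<Longrightarrow> block_index m x c = l * m + 1 + r \<longleftrightarrow>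
     0 < x \<and> (nat x - 1) div m = l \<and> (nat x - 1 + c) mod m = r"
  using m_pos by (auto simp: block_index_def div_mod_eq_iff)

text \<open>Colour 0 of the opening base sits at offset \<open>m - 1\<close>, the last of its group;
  raising the colour by \<open>r + 1\<close> wraps around to offset \<open>r\<close>. This is why
  colour \<open>j mod m\<close> lies in block \<open>j\<close>.\<close>

lemma block_index_opening: "r < m \<Longrightarrow> block_index m (int (Suc l * m)) (Suc r) = l * m + 1 + r"
proof -
  assume r: "r < m"
  have *: "nat (int (Suc l * m)) - 1 = l * m + (m - 1)" using m_pos by (simp del: of_nat_mult)
  have "l * m + (m - 1) + Suc r = Suc l * m + r" using m_pos by simp
  then have "(l * m + (m - 1) + Suc r) mod m = r" using r by (metis mod_mult_self3 mod_less)
  moreover have "(l * m + (m - 1)) div m = l" using m_pos by (subst div_mult_self3) auto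
  moreover have "0 < int (Suc l * m)" using m_pos by (simp del: of_nat_mult)
  ultimately show ?thesis unfolding block_index_iff[OF r] * by blast
qed

lemma block_number_le: "l < k \<Longrightarrow> r < m \<Longrightarrow> l * m + 1 + r \<le> k * m"
  using mult_le_mono1[of "Suc l" k m] by simp

lemma block_number_cases:
  assumes "0 < j" "j \<le> k * m"
  obtains l r where "l < k" "r < m" "j = l * m + 1 + r"
proof
  show "(j - 1) div m < k" using assms m_pos by (simp add: less_mult_imp_div_less)
  show "(j - 1) mod m < m" using m_pos by simp
  show "j = (j - 1) div m * m + 1 + (j - 1) mod m" using assms by simp
qed

lemma block_number_mod: "r < m \<Longrightarrow> (l * m + 1 + r) mod m = Suc r mod m"
  by (metis Suc_eq_plus1_left add.assoc mod_mult_self3)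

lemma block_number_last: "Suc l * m = l * m + 1 + (m - 1)"
  using m_pos by simp

lemma block_index_le: "x \<le> int (k * m) \<Longrightarrow> block_index m x c \<le> k * m"
proof (cases "x \<le> 0")
  case False
  assume "x \<le> int (k * m)"
  then have "nat x \<le> k * m" by linarith
  then have "(nat x - 1) div m < k" using False m_pos by (intro less_mult_imp_div_less) auto
  then show ?thesis using False m_pos block_number_le by (simp add: block_index_def)
qed (simp add: block_index_def)

lemma col_in_blk_iff: "col m i c \<in> blk m n a j \<longleftrightarrow> i \<in> {1..n} \<and> block_index m (a i) c = j"
proof
  assume "col m i c \<in> blk m n a j"
  then obtain d where "i \<in> {1..n}" "c mod m = d mod m" "block_index m (a i) d = j"
    by (auto simp: blk_def col_eq_iff split: if_splits)
  then show "i \<in> {1..n} \<and> block_index m (a i) c = j" by (metis block_index_mod)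
next
  assume *: "i \<in> {1..n} \<and> block_index m (a i) c = j"
  then have "col m i (c mod m) \<in> blk m n a j" using m_pos unfolding blk_def by fastforce
  then show "col m i c \<in> blk m n a j" by (simp add: col_mod)
qed

lemma zvec_in_blk_iff: "zvec \<in> blk m n a j \<longleftrightarrow> j = 0"
  by (auto simp: blk_def)

lemma blk_cases:
  assumes "x \<in> blk m n a j"
  obtains "x = zvec" "j = 0"
    | i c where "x = col m i c" "c < m" "i \<in> {1..n}" "block_index m (a i) c = j"
  using assms by (auto simp: blk_def split: if_splits)

lemma blk_disjoint: "x \<in> blk m n a j \<Longrightarrow> x \<in> blk m n a j' \<Longrightarrow> j = j'"
  by (erule blk_cases) (auto simp: zvec_in_blk_iff col_in_blk_iff)

text \<open>Multiplication by \<open>zeta m ^ d\<close> raises every colour by \<open>d\<close>, and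
  hence rotates the labels of the group by \<open>d\<close>.\<close>

lemma scale_blk:
  assumes r: "r < m"
  shows "scale (zeta m ^ d) (blk m n a (l * m + 1 + r)) = blk m n a (l * m + 1 + (r + d) mod m)"
proof (intro set_eqI iffI)
  have r': "(r + d) mod m < m" using m_pos by simp
  fix x
  assume "x \<in> scale (zeta m ^ d) (blk m n a (l * m + 1 + r))"
  then obtain y where y: "y \<in> blk m n a (l * m + 1 + r)" "x = (\<lambda>j. zeta m ^ d * y j)"
    by (auto simp: scale_def)
  from y(1) show "x \<in> blk m n a (l * m + 1 + (r + d) mod m)"
  proof (cases rule: blk_cases)
    case (2 i c)
    have "(nat (a i) - 1 + (c + d)) mod m = (r + d) mod m"
      using 2(4) unfolding block_index_iff[OF r] by (metis add.assoc mod_add_left_eq)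
    then show ?thesis
      using 2 unfolding y(2) 2(1) zeta_col col_in_blk_iff block_index_iff[OF r] block_index_iff[OF r'] by simp
  qed simp
next
  have r': "(r + d) mod m < m" using m_pos by simp
  fix x
  assume "x \<in> blk m n a (l * m + 1 + (r + d) mod m)"
  then show "x \<in> scale (zeta m ^ d) (blk m n a (l * m + 1 + r))"
  proof (cases rule: blk_cases)
    case (2 i c)
    \<comment> \<open>The colour \<open>c - d\<close> modulo \<open>m\<close>, whose rotation by
      \<open>d\<close> is the given element.\<close>
    define c' where "c' = c + d * (m - 1)"
    have x: "x = col m i (c' + d)" unfolding 2(1) c'_def col_eq_iff mod_shift by simp
    have "(nat (a i) - 1 + c') mod m = (nat (a i) - 1 + c + d * (m - 1)) mod m"
      by (simp add: c'_def add.assoc)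
    also have "\<dots> = (r + d + d * (m - 1)) mod m"
      using 2(4) unfolding block_index_iff[OF r'] by (metis mod_add_left_eq)
    also have "\<dots> = r" using mod_shift[of r d] r by (simp add: add_ac)
    finally have "(nat (a i) - 1 + c') mod m = r" .
    then show ?thesis
      using 2(3,4) unfolding x col_in_scale col_in_blk_iff block_index_iff[OF r] block_index_iff[OF r'] by simp
  qed simp
qed

subsection \<open>The super set partition of a growth word\<close>

context
  fixes n k :: nat and a :: "nat \<Rightarrow> int" and s :: "nat \<Rightarrow> nat"
  assumes s: "openings m n k a s"
begin

lemma openingsD:
  "l < k \<Longrightarrow> l' < k \<Longrightarrow> l < l' \<Longrightarrow> s l < s l'"
  "l < k \<Longrightarrow> s l \<in> {1..n}"
  "l < k \<Longrightarrow> a (s l) = int (Suc l * m)"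
  "i \<in> {1..n} \<Longrightarrow> 2 - int m \<le> a i"
  "i \<in> {1..n} \<Longrightarrow> a i \<le> int (k * m)"
  "i \<in> {1..n} \<Longrightarrow> l < k \<Longrightarrow> int (l * m) < a i \<Longrightarrow> s l \<le> i"
  using s unfolding openings_def strict_mono_on_def by blast+

text \<open>The opening base of a group meets each of its \<open>m\<close> blocks; this gives both
  nonemptiness and the colour condition of the standard form.\<close>

lemma opening_in_blk: "l < k \<Longrightarrow> r < m \<Longrightarrow> col m (s l) (Suc r) \<in> blk m n a (l * m + 1 + r)"
  using openingsD(2,3)[of l] block_index_opening[of r l] by (simp add: col_in_blk_iff del: of_nat_mult)

lemma blk_nonempty: "j \<le> k * m \<Longrightarrow> blk m n a j \<noteq> {}"
proof (cases "j = 0")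
  case True
  then show ?thesis using zvec_in_blk_iff[of n a j] by auto
next
  case False
  assume "j \<le> k * m"
  then obtain l r where "l < k" "r < m" "j = l * m + 1 + r" using block_number_cases False by blast
  then show ?thesis using opening_in_blk by blast
qed

lemma inj_on_blk: "inj_on (blk m n a) {..k * m}"
  by (rule inj_onI) (metis atMost_iff blk_disjoint blk_nonempty ex_in_conv)

text \<open>A base occurring in group \<open>l\<close> has a letter above \<open>l * m\<close>, so
  by \<open>openings\<close> it is not before \<open>s l\<close>, which itself occurs in the
  block.\<close>

lemma minb_blk: "l < k \<Longrightarrow> r < m \<Longrightarrow> minb m (blk m n a (l * m + 1 + r)) = s l"
proof -
  assume l: "l < k" and r: "r < m"
  have "s l \<le> i" if "\<exists>c. col m i c \<in> blk m n a (l * m + 1 + r)" for i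
  proof -
    from that obtain c where i: "i \<in> {1..n}" "0 < a i" "(nat (a i) - 1) div m = l"
      unfolding col_in_blk_iff block_index_iff[OF r] by blast
    have "l * m \<le> nat (a i) - 1" using i(3) by (metis div_times_less_eq_dividend)
    then have "int (l * m) < a i" using i(2) by linarith
    then show ?thesis using openingsD(6) i(1) l by blast
  qed
  then show ?thesis
    unfolding minb_def Ex_col_iff
    using opening_in_blk[OF l r] by (auto simp: zvec_in_blk_iff intro!: Least_equality)
qed

lemma blk_partition: "partition_on (colored_numbers m n) (blk m n a ` {..k * m})"
proof (rule partition_onI)
  show "\<Union> (blk m n a ` {..k * m}) = colored_numbers m n"
  proof (intro set_eqI iffI)
    fix x assume "x \<in> \<Union> (blk m n a ` {..k * m})"
    then show "x \<in> colored_numbers m n"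
      by (auto simp: colored_numbers_def elim!: blk_cases)
  next
    fix x assume "x \<in> colored_numbers m n"
    then consider "x = zvec" | i c where "x = col m i c" "i \<in> {1..n}"
      by (auto simp: colored_numbers_def)
    then show "x \<in> \<Union> (blk m n a ` {..k * m})"
    proof cases
      case 1
      then show ?thesis using zvec_in_blk_iff[of n a 0] by auto
    next
      case 2
      then have "x \<in> blk m n a (block_index m (a i) c)" by (simp add: col_in_blk_iff)
      then show ?thesis using block_index_le[OF openingsD(5)[OF 2(2)]] by auto
    qed
  qed
  show "disjnt p p'" if "p \<in> blk m n a ` {..k * m}" "p' \<in> blk m n a ` {..k * m}" "p \<noteq> p'" for p p'
    using that blk_disjoint unfolding disjnt_iff by blast
  show "{} \<notin> blk m n a ` {..k * m}" using blk_nonempty by (metis atMost_iff imageE)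
qed

lemma blk_standard: "is_standard_form m n k (blk m n a ` {..k * m}) (map (blk m n a) [0..<k * m + 1])"
proof -
  define Bs where "Bs = map (blk m n a) [0..<k * m + 1]"
  have nth: "Bs ! j = blk m n a j" if "j \<le> k * m" for j
    unfolding Bs_def using that by (subst nth_map) (simp_all del: upt_Suc)
  have "{0..<k * m + 1} = {..k * m}" by auto
  then have Bs: "length Bs = k * m + 1" "distinct Bs" "set Bs = blk m n a ` {..k * m}"
    using inj_on_blk unfolding Bs_def by (simp_all add: distinct_map del: upt_Suc)
  have minb0: "minb m (blk m n a 0) = 0" by (simp add: minb_def zvec_in_blk_iff)
  have last: "minb m (Bs ! (Suc l * m)) = s l" if "l < k" for l
    using minb_blk[OF that, of "m - 1"] m_pos that
    by (subst nth) (simp_all only: block_number_last block_number_le diff_less zero_less_one)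
  have "\<exists>S. \<forall>r<m. Bs ! (l * m + 1 + r) = scale (zeta m ^ r) S" if l: "l < k" for l
  proof (intro exI allI impI)
    fix r assume r: "r < m"
    show "Bs ! (l * m + 1 + r) = scale (zeta m ^ r) (blk m n a (l * m + 1 + 0))"
      using block_number_le[OF l r] r by (subst scale_blk[OF m_pos]) (simp only: nth add_0 mod_less)
  qed
  moreover have "minb m (Bs ! (l * m)) < minb m (Bs ! ((l + 1) * m))" if l: "l < k" for l
  \<comment> \<open>For \<open>l = 0\<close> the left block is the zero block, with
    \<open>minb\<close> 0, and \<open>s 0 \<ge> 1\<close>; otherwise both blocks end a group and
    \<open>s\<close> is increasing.\<close>
  proof (cases l)
    case 0
    then show ?thesis using last[OF l] openingsD(2)[OF l] minb0 by (simp add: nth del: upt_Suc)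
  next
    case (Suc l')
    then have "minb m (Bs ! (l * m)) = s l'" using last[of l'] l by simp
    then show ?thesis using last[OF l] openingsD(1)[of l' l] l Suc by simp
  qed
  moreover have "col m (minb m (Bs ! j)) (j mod m) \<in> Bs ! j" if j: "j \<in> {1..k * m}" for j
  proof -
    obtain l r where lr: "l < k" "r < m" "j = l * m + 1 + r"
      using j block_number_cases[of j k] by auto
    then show ?thesis using opening_in_blk[OF lr(1,2)] nth[OF block_number_le[OF lr(1,2)]] minb_blk[OF lr(1,2)]
      unfolding lr(3) block_number_mod[OF lr(2)] col_mod by (simp only:)
  qed
  moreover have "Bs ! 0 = blk m n a 0" by (rule nth) simp
  ultimately have "is_standard_form m n k (blk m n a ` {..k * m}) Bs"
    unfolding is_standard_form_def block_labelling_def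
    using minb0 Bs by (simp add: zvec_in_blk_iff col_in_blk_iff block_index_eq_0_iff)
  then show ?thesis by (simp only: Bs_def)
qed

end

subsection \<open>Existence and uniqueness of the standard form\<close>

context
  fixes n k :: nat and P :: "(nat \<Rightarrow> complex) set set" and Bs :: "(nat \<Rightarrow> complex) set list"
  assumes P: "partition_on (colored_numbers m n) P"
    and lab: "block_labelling m n k P Bs"
begin

lemma labelling_in: "j \<le> k * m \<Longrightarrow> Bs ! j \<in> P"
  using lab unfolding block_labelling_def by (metis Suc_eq_plus1 le_imp_less_Suc nth_mem)

lemma labelling_disjoint:
  assumes "i \<le> k * m" "j \<le> k * m" "x \<in> Bs ! i" "x \<in> Bs ! j"
  shows "i = j"
proof -
  have "Bs ! i = Bs ! j"
    using partition_on_block_eq[OF P] labelling_in assms by metis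
  then show ?thesis
    using lab assms(1,2) unfolding block_labelling_def by (auto simp: nth_eq_iff_index_eq)
qed

lemma labelling_obtain:
  assumes "B \<in> P"
  obtains j where "j \<le> k * m" "B = Bs ! j"
  using lab assms unfolding block_labelling_def in_set_conv_nth[symmetric] by (metis Suc_eq_plus1 in_set_conv_nth less_Suc_eq_le)

lemma zvec_in_labelling: "j \<le> k * m \<Longrightarrow> zvec \<in> Bs ! j \<longleftrightarrow> j = 0"
  using labelling_disjoint[of 0 j zvec] lab unfolding block_labelling_def by auto

lemma labelling_scale:
  assumes "l < k" "r < m"
  shows "scale (zeta m ^ d) (Bs ! (l * m + 1 + r)) = Bs ! (l * m + 1 + (r + d) mod m)"
proof -
  obtain S where S: "\<And>r. r < m \<Longrightarrow> Bs ! (l * m + 1 + r) = scale (zeta m ^ r) S"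
    using lab assms unfolding block_labelling_def by blast
  have "(r + d) mod m < m" using m_pos by simp
  show ?thesis
    unfolding S[OF assms(2)] S[OF \<open>(r + d) mod m < m\<close>] scale_zeta_mod
    by (simp only: scale_scale power_add mult.commute)
qed

text \<open>Rotation carries the block to the last one of its group and changes colours only, not
  bases.\<close>

lemma labelling_minb:
  assumes "l < k" "r < m"
  shows "minb m (Bs ! (l * m + 1 + r)) = minb m (Bs ! (Suc l * m))"
proof -
  have "(r + (m - 1 - r)) mod m = m - 1" using assms m_pos by simp
  then show ?thesis
    using labelling_scale[OF assms, of "m - 1 - r"] minb_scale unfolding block_number_last by metis
qed

lemma labelling_col:
  assumes "x \<in> Bs ! j" "j \<le> k * m"
  shows "x \<in> colored_numbers m n"
  using P labelling_in[OF assms(2)] assms(1) unfolding partition_on_def by blast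

lemma labelling_minb_props:
  assumes j: "0 < j" "j \<le> k * m"
  shows "\<exists>c. col m (minb m (Bs ! j)) c \<in> Bs ! j" and "minb m (Bs ! j) \<in> {1..n}"
    and "col m i c \<in> Bs ! j \<Longrightarrow> minb m (Bs ! j) \<le> i"
proof -
  have z: "zvec \<notin> Bs ! j" using j zvec_in_labelling by simp
  have minb: "minb m (Bs ! j) = (LEAST i. \<exists>c. col m i c \<in> Bs ! j)"
    using z by (simp add: minb_def Ex_col_iff)
  have "Bs ! j \<noteq> {}" using P labelling_in[OF j(2)] unfolding partition_on_def by metis
  then obtain x where x: "x \<in> Bs ! j" by blast
  then have "x \<in> colored_numbers m n" "x \<noteq> zvec" using labelling_col j z by auto
  then have "\<exists>i c. col m i c \<in> Bs ! j" using x by (auto simp: colored_numbers_def)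
  then show *: "\<exists>c. col m (minb m (Bs ! j)) c \<in> Bs ! j" unfolding minb by (rule LeastI_ex)
  show "minb m (Bs ! j) \<le> i" if "col m i c \<in> Bs ! j" for i c
    unfolding minb by (rule Least_le) (use that in blast)
  obtain c where "col m (minb m (Bs ! j)) c \<in> colored_numbers m n"
    using * labelling_col j by blast
  then show "minb m (Bs ! j) \<in> {1..n}" by (auto simp: colored_numbers_def col_eq_iff)
qed

text \<open>The right-hand side does not mention the labelling, so the set of least bases of the
  groups is an invariant of \<open>P\<close>.\<close>

lemma labelling_minb_image:
  "(\<lambda>l. minb m (Bs ! (Suc l * m))) ` {..<k} = minb m ` {B \<in> P. zvec \<notin> B}"
proof (intro set_eqI iffI)
  fix x assume "x \<in> (\<lambda>l. minb m (Bs ! (Suc l * m))) ` {..<k}"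
  then obtain l where l: "l < k" "x = minb m (Bs ! (Suc l * m))" by auto
  then have "Suc l * m \<le> k * m" "0 < Suc l * m"
    using mult_le_mono1[of "Suc l" k m] m_pos by simp_all
  then have "Bs ! (Suc l * m) \<in> {B \<in> P. zvec \<notin> B}"
    using labelling_in zvec_in_labelling by (metis (no_types, lifting) mem_Collect_eq nat_less_le)
  then show "x \<in> minb m ` {B \<in> P. zvec \<notin> B}" unfolding l(2) by (rule imageI)
next
  fix x assume "x \<in> minb m ` {B \<in> P. zvec \<notin> B}"
  then obtain j where j: "j \<le> k * m" "zvec \<notin> Bs ! j" "x = minb m (Bs ! j)"
    by (auto elim: labelling_obtain)
  then have "0 < j" using zvec_in_labelling by blast
  then obtain l r where "l < k" "r < m" "j = l * m + 1 + r" using j block_number_cases by blast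
  then show "x \<in> (\<lambda>l. minb m (Bs ! (Suc l * m))) ` {..<k}"
    using labelling_minb j(3) by blast
qed

text \<open>If two groups share their least base, a rotation of a block of the first contains an
  element of a block of the second. Then the two blocks coincide, and so do the groups.\<close>

lemma inj_on_labelling_minb: "inj_on (\<lambda>l. minb m (Bs ! (Suc l * m))) {..<k}"
proof (rule inj_onI)
  fix l l'
  assume l: "l \<in> {..<k}" "l' \<in> {..<k}"
    and eq: "minb m (Bs ! (Suc l * m)) = minb m (Bs ! (Suc l' * m))" (is "?i = _")
  then have lk: "l < k" "l' < k" by auto
  have bound: "0 < Suc l * m" "Suc l * m \<le> k * m" "0 < Suc l' * m" "Suc l' * m \<le> k * m"
    using lk mult_le_mono1[of "Suc l" k m] mult_le_mono1[of "Suc l'" k m] m_pos by simp_all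
  obtain c where c: "col m ?i c \<in> Bs ! (Suc l * m)"
    using labelling_minb_props(1)[OF bound(1,2)] by blast
  obtain c' where c': "col m ?i c' \<in> Bs ! (Suc l' * m)"
    using labelling_minb_props(1)[OF bound(3,4)] eq by metis
  \<comment> \<open>The difference \<open>c' - c\<close> modulo \<open>m\<close>, which turns colour
    \<open>c\<close> into \<open>c'\<close>.\<close>
  define d where "d = c' + c * (m - 1)"
  have m1: "m - 1 < m" using m_pos by simp
  have r: "(m - 1 + d) mod m < m" using m_pos by simp
  have "col m ?i (c + d) \<in> scale (zeta m ^ d) (Bs ! (Suc l * m))"
    using c by (simp only: col_in_scale)
  also have "col m ?i (c + d) = col m ?i c'"
    unfolding d_def by (simp only: col_eq_iff mod_shift_left)
  also have "scale (zeta m ^ d) (Bs ! (Suc l * m)) = Bs ! (l * m + 1 + (m - 1 + d) mod m)"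
    unfolding block_number_last by (rule labelling_scale[OF lk(1) m1])
  finally have "l * m + 1 + (m - 1 + d) mod m = Suc l' * m"
    using labelling_disjoint[OF block_number_le[OF lk(1) r] bound(4) _ c'] by blast
  then have "l * m + (m - 1 + d) mod m = l' * m + (m - 1)" unfolding block_number_last by linarith
  then show "l = l'" using div_mod_eq_iff[OF r m1] by blast
qed

text \<open>Sort the groups of a given labelling by their least bases, then rotate each group until
  its first block contains colour 1 of that base.\<close>

lemma standard_form_exists: "\<exists>Bs'. is_standard_form m n k P Bs'"
proof -
  define t where "t l = minb m (Bs ! (Suc l * m))" for l
  define ss where "ss = sorted_list_of_set (t ` {..<k})"
  have inj: "inj_on t {..<k}" unfolding t_def by (rule inj_on_labelling_minb)
  have ss: "length ss = k" "set ss = t ` {..<k}" "sorted_wrt (<) ss"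
    using inj by (simp_all add: ss_def card_image)
  \<comment> \<open>The old index of the group that is placed at index \<open>l\<close>.\<close>
  define p where "p l = inv_into {..<k} t (ss ! l)" for l
  have p: "p l < k" "t (p l) = ss ! l" if "l < k" for l
  proof -
    have "ss ! l \<in> t ` {..<k}" using ss that nth_mem by blast
    then show "p l < k" "t (p l) = ss ! l"
      unfolding p_def using inv_into_into[of "ss ! l" t "{..<k}"] by (simp_all add: f_inv_into_f)
  qed
  have p_surj: "\<exists>l<k. p l = l'" if "l' < k" for l'
  proof -
    have "t l' \<in> set ss" using that ss by blast
    then obtain l where l: "l < k" "ss ! l = t l'" using ss(1) by (metis in_set_conv_nth)
    have "p l = l'" unfolding p_def l(2) using inj that by simp
    then show ?thesis using l(1) by blast
  qed
  have minb_first: "minb m (Bs ! (l * m + 1 + 0)) = t l" if "l < k" for l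
    unfolding t_def by (rule labelling_minb[OF that m_pos])
  have "\<exists>e. col m (ss ! l) 1 \<in> scale (zeta m ^ e) (Bs ! (p l * m + 1 + 0))" if l: "l < k" for l
  proof -
    have "p l * m + 1 + 0 \<le> k * m" by (rule block_number_le[OF p(1)[OF l] m_pos])
    moreover have "0 < p l * m + 1 + 0" by simp
    moreover have "minb m (Bs ! (p l * m + 1 + 0)) = ss ! l"
      using minb_first[OF p(1)[OF l]] p(2)[OF l] by (rule trans)
    ultimately obtain c where "col m (ss ! l) c \<in> Bs ! (p l * m + 1 + 0)"
      using labelling_minb_props(1)[of "p l * m + 1 + 0"] by metis
    \<comment> \<open>The exponent is \<open>1 - c\<close> modulo \<open>m\<close>, which takes
      colour \<open>c\<close> to colour 1.\<close>
    then have "col m (ss ! l) (c + (1 + c * (m - 1))) \<in> scale (zeta m ^ (1 + c * (m - 1))) (Bs ! (p l * m + 1 + 0))"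
      by (simp only: col_in_scale)
    moreover have "col m (ss ! l) (c + (1 + c * (m - 1))) = col m (ss ! l) 1"
      by (simp only: col_eq_iff mod_shift_left)
    ultimately show ?thesis by metis
  qed
  then obtain e where e: "\<And>l. l < k \<Longrightarrow> col m (ss ! l) 1 \<in> scale (zeta m ^ e l) (Bs ! (p l * m + 1 + 0))"
    by metis
  define S where "S l = scale (zeta m ^ e l) (Bs ! (p l * m + 1 + 0))" for l
  define Bs' where "Bs' = map (\<lambda>j. if j = 0 then Bs ! 0
      else scale (zeta m ^ ((j - 1) mod m)) (S ((j - 1) div m))) [0..<k * m + 1]"
  have len: "length Bs' = k * m + 1" by (simp add: Bs'_def)
  have Bs'_nth: "Bs' ! j = (if j = 0 then Bs ! 0
      else scale (zeta m ^ ((j - 1) mod m)) (S ((j - 1) div m)))" if "j \<le> k * m" for j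
    unfolding Bs'_def using that by (subst nth_map) (simp_all del: upt_Suc)
  have Bs'_0: "Bs' ! 0 = Bs ! 0" by (simp add: Bs'_nth)
  have Bs': "Bs' ! (l * m + 1 + r) = scale (zeta m ^ r) (S l)" if "l < k" "r < m" for l r
    using that by (subst Bs'_nth[OF block_number_le[OF that]]) simp
  \<comment> \<open>The new labelling permutes the groups by \<open>p\<close> and rotates group
    \<open>l\<close> by \<open>e l\<close>, so it lists the same blocks.\<close>
  have Bs'_Bs: "Bs' ! (l * m + 1 + r) = Bs ! (p l * m + 1 + (e l + r) mod m)" if "l < k" "r < m" for l r
    unfolding Bs'[OF that] S_def scale_scale
    using labelling_scale[OF p(1)[OF that(1)] m_pos, of "r + e l"]
    by (simp add: power_add add.commute)
  have "set Bs' = P"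
  proof (intro set_eqI iffI)
    fix B assume "B \<in> set Bs'"
    then obtain j where j: "j \<le> k * m" "B = Bs' ! j" using len by (metis Suc_eq_plus1 in_set_conv_nth less_Suc_eq_le)
    show "B \<in> P"
    proof (cases "j = 0")
      case True
      then show ?thesis using j Bs'_0 labelling_in[of 0] by simp
    next
      case False
      then obtain l r where lr: "l < k" "r < m" "j = l * m + 1 + r" using j block_number_cases by blast
      then show ?thesis
        using j(2) Bs'_Bs[OF lr(1,2)] labelling_in[OF block_number_le[OF p(1)[OF lr(1)]]] m_pos by simp
    qed
  next
    fix B assume "B \<in> P"
    then obtain j where j: "j \<le> k * m" "B = Bs ! j" by (rule labelling_obtain)
    show "B \<in> set Bs'"
    proof (cases "j = 0")
      case True
      then show ?thesis using j Bs'_0 len by (metis add_gr_0 nth_mem zero_less_one)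
    next
      case False
      then obtain l' r' where lr': "l' < k" "r' < m" "j = l' * m + 1 + r'"
        using j block_number_cases by blast
      then obtain l where l: "l < k" "p l = l'" using p_surj by blast
      \<comment> \<open>This is \<open>r' - e l\<close> modulo \<open>m\<close>, the offset that the
        rotation of the group sends to \<open>r'\<close>.\<close>
      define r where "r = (r' + e l * (m - 1)) mod m"
      have r: "r < m" using m_pos by (simp add: r_def)
      have "(e l + r) mod m = (e l + (r' + e l * (m - 1))) mod m"
        unfolding r_def by (rule mod_add_right_eq)
      also have "\<dots> = r'" using lr'(2) by (simp only: mod_shift_left mod_less)
      finally have "B = Bs' ! (l * m + 1 + r)" using Bs'_Bs[OF l(1) r] l(2) j(2) lr'(3) by simp
      then show ?thesis using len block_number_le[OF l(1) r] by (metis Suc_eq_plus1 le_imp_less_Suc nth_mem)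
    qed
  qed
  \<comment> \<open>Both lists have the same length and the same set of entries, and the old one is
    distinct.\<close>
  moreover from this have "distinct Bs'"
    using lab len unfolding block_labelling_def by (metis card_distinct distinct_card)
  moreover have "\<exists>S. \<forall>r<m. Bs' ! (l * m + 1 + r) = scale (zeta m ^ r) S" if "l < k" for l
    using Bs'[OF that] by blast
  ultimately have "block_labelling m n k P Bs'"
    using lab len unfolding block_labelling_def Bs'_0 by blast
  moreover have minb: "minb m (Bs' ! (l * m + 1 + r)) = ss ! l" if "l < k" "r < m" for l r
    using minb_first[OF p(1)] p(2) that by (simp only: Bs'[OF that] S_def minb_scale)
  moreover have last: "minb m (Bs' ! (Suc l * m)) = ss ! l" if "l < k" for l
    unfolding block_number_last by (rule minb[OF that]) (use m_pos in simp)
  moreover have minb0: "minb m (Bs' ! 0) = 0"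
    using zvec_in_labelling[of 0] by (simp add: Bs'_0 minb_def)
  moreover have "minb m (Bs' ! (l * m)) < minb m (Bs' ! ((l + 1) * m))" if l: "l < k" for l
  proof (cases l)
    case 0
    have "0 < Suc (p l) * m" "Suc (p l) * m \<le> k * m"
      using p(1)[OF l] mult_le_mono1[of "Suc (p l)" k m] m_pos by simp_all
    then have "t (p l) \<in> {1..n}" using labelling_minb_props(2)[of "Suc (p l) * m"] by (simp only: t_def)
    then show ?thesis using last[OF l] p(2)[OF l] minb0 0 by simp
  next
    case (Suc l')
    then have "ss ! l' < ss ! l" using ss l by (auto intro: sorted_wrt_nth_less)
    then show ?thesis using last[of l'] last[OF l] Suc l by simp
  qed
  moreover have "col m (minb m (Bs' ! j)) (j mod m) \<in> Bs' ! j" if j: "j \<in> {1..k * m}" for j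
  proof -
    obtain l r where lr: "l < k" "r < m" "j = l * m + 1 + r"
      using j block_number_cases[of j k] by auto
    have "col m (ss ! l) (1 + r) \<in> scale (zeta m ^ r) (S l)"
      using e[OF lr(1)] by (simp only: S_def col_in_scale)
    then show ?thesis
      unfolding lr(3) minb[OF lr(1,2)] unfolding block_number_mod[OF lr(2)] Bs'[OF lr(1,2)] col_mod by simp
  qed
  ultimately show ?thesis unfolding is_standard_form_def by blast
qed

end

lemma standard_form_sorted:
  assumes "is_standard_form m n k P Bs"
  shows "sorted_wrt (<) (map (\<lambda>l. minb m (Bs ! (Suc l * m))) [0..<k])"
proof -
  have "minb m (Bs ! (Suc i * m)) < minb m (Bs ! (Suc (Suc i) * m))" if "Suc i < k" for i
    using assms that unfolding is_standard_form_def by (metis Suc_eq_plus1)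
  then show ?thesis by (subst sorted_wrt_iff_nth_Suc_transp) (auto simp del: mult_Suc)
qed

text \<open>The least bases of the groups are the increasing enumeration of a set depending on
  \<open>P\<close> only. They prescribe an element of each nonzero block, so equally labelled blocks
  share an element and agree.\<close>

lemma standard_form_unique:
  assumes P: "partition_on (colored_numbers m n) P"
    and Bs: "is_standard_form m n k P Bs" and Bs': "is_standard_form m n k P Bs'"
  shows "Bs = Bs'"
proof (rule nth_equalityI)
  have lab: "block_labelling m n k P Bs" "block_labelling m n k P Bs'"
    using Bs Bs' by (simp_all add: is_standard_form_def)
  then have len: "length Bs = k * m + 1" "length Bs' = k * m + 1"
    by (simp_all add: block_labelling_def)
  then show "length Bs = length Bs'" by simp
  have "set (map (\<lambda>l. minb m (Bs ! (Suc l * m))) [0..<k]) = set (map (\<lambda>l. minb m (Bs' ! (Suc l * m))) [0..<k])"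
    using labelling_minb_image[OF P lab(1)] labelling_minb_image[OF P lab(2)]
    by (simp add: atLeast0LessThan)
  then have "map (\<lambda>l. minb m (Bs ! (Suc l * m))) [0..<k] = map (\<lambda>l. minb m (Bs' ! (Suc l * m))) [0..<k]"
    by (intro strict_sorted_equal standard_form_sorted[OF Bs] standard_form_sorted[OF Bs']) simp
  then have t: "minb m (Bs ! (Suc l * m)) = minb m (Bs' ! (Suc l * m))" if "l < k" for l
    using that by (simp del: mult_Suc)
  fix j assume "j < length Bs"
  then have j: "j \<le> k * m" using len by simp
  have "\<exists>x. x \<in> Bs ! j \<and> x \<in> Bs' ! j"
  proof (cases "j = 0")
    case True
    then show ?thesis using lab unfolding block_labelling_def by blast
  next
    case False
    then obtain l r where lr: "l < k" "r < m" "j = l * m + 1 + r" using j block_number_cases by blast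
    have "minb m (Bs ! j) = minb m (Bs' ! j)"
      unfolding lr(3) labelling_minb[OF P lab(1) lr(1,2)] labelling_minb[OF P lab(2) lr(1,2)] by (rule t[OF lr(1)])
    moreover have "j \<in> {1..k * m}" using j False by simp
    ultimately show ?thesis using Bs Bs' unfolding is_standard_form_def by metis
  qed
  then show "Bs ! j = Bs' ! j"
    using partition_on_block_eq[OF P labelling_in[OF P lab(1) j] labelling_in[OF P lab(2) j]] by blast
qed

lemma standard_form_eq:
  assumes "partition_on (colored_numbers m n) P" "is_standard_form m n k P Bs"
  shows "standard_form m n k P = Bs"
  unfolding standard_form_def
  by (rule the_equality) (use assms standard_form_unique in blast)+

lemma zero_block_eq:
  assumes "partition_on (colored_numbers m n) P" "B \<in> P" "zvec \<in> B"
  shows "zero_block P = B"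
  unfolding zero_block_def
  by (rule the_equality) (use assms partition_on_block_eq[OF assms(1)] in blast)+

subsection \<open>The bijection between growth words and super set partitions\<close>

text \<open>In the ordering starting with exponent \<open>c0\<close>, colour 0 stands at position
  \<open>m - c0\<close>, and exactly the colours \<open>1, ..., c0 - 1\<close> follow it.\<close>

lemma order_positions:
  assumes c0: "0 < c0" "c0 < m" and "c < m"
  shows "(\<exists>p b. p < b \<and> b < m \<and> (c0 + p) mod m = 0 \<and> (c0 + b) mod m = c) \<longleftrightarrow> 0 < c \<and> c < c0"
proof
  assume "\<exists>p b. p < b \<and> b < m \<and> (c0 + p) mod m = 0 \<and> (c0 + b) mod m = c"
  then obtain p b where pb: "p < b" "b < m" "(c0 + p) mod m = 0" "(c0 + b) mod m = c" by metis
  \<comment> \<open>From position \<open>m - c0\<close> on the exponents have wrapped around exactly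
    once, since \<open>c0 + x < 2 * m\<close>.\<close>
  have wrap: "(c0 + x) mod m = c0 + x - m" if "m \<le> c0 + x" "x < m" for x
  proof -
    have "c0 + x - m < m" using that c0 by linarith
    then show ?thesis unfolding le_mod_geq[OF that(1)] by (rule mod_less)
  qed
  have "m \<le> c0 + p"
  proof (rule ccontr)
    assume "\<not> m \<le> c0 + p"
    then have "(c0 + p) mod m = c0 + p" by (intro mod_less) simp
    then show False using pb(3) c0(1) by linarith
  qed
  moreover have "p < m" using pb by linarith
  ultimately have "c0 + p - m = 0" using wrap[of p] pb(3) by metis
  moreover have "c0 + b - m = c"
    using wrap[of b] pb \<open>m \<le> c0 + p\<close> by (metis add_le_cancel_left le_trans less_imp_le)
  ultimately show "0 < c \<and> c < c0" using pb c0 \<open>m \<le> c0 + p\<close> by linarith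
next
  assume c: "0 < c \<and> c < c0"
  have "c0 + (c + m - c0) = c + m" "c0 + (m - c0) = m" using c0 by linarith+
  then have "(c0 + (c + m - c0)) mod m = c" "(c0 + (m - c0)) mod m = 0" using \<open>c < m\<close> by simp_all
  moreover have "m - c0 < c + m - c0" "c + m - c0 < m" using c c0 by linarith+
  ultimately show "\<exists>p b. p < b \<and> b < m \<and> (c0 + p) mod m = 0 \<and> (c0 + b) mod m = c"
    by (intro exI[of _ "m - c0"] exI[of _ "c + m - c0"] conjI)
qed

section \<open>The super set partition of a word and its inversion number\<close>

context
  fixes n k :: nat and a :: "nat \<Rightarrow> int" and s :: "nat \<Rightarrow> nat"
  assumes s: "openings m n k a s"
begin

lemma standard_form_blk:
  "standard_form m n k (blk m n a ` {..k * m}) = map (blk m n a) [0..<k * m + 1]"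
  by (rule standard_form_eq[OF blk_partition[OF s] blk_standard[OF s]])

lemma zero_bases_blk: "zero_bases m n (blk m n a ` {..k * m}) = {i \<in> {1..n}. a i \<le> 0}"
proof -
  have "zero_block (blk m n a ` {..k * m}) = blk m n a 0"
    by (rule zero_block_eq[OF blk_partition[OF s]]) (auto simp: zvec_in_blk_iff)
  then show ?thesis
    using m_pos by (auto simp: zero_bases_def col_in_blk_iff block_index_eq_0_iff)
qed

lemma of_word_in: "of_word m n k a \<in> super_set_partitions m n k"
proof -
  note st = blk_standard[OF s]
  have lab: "block_labelling m n k (blk m n a ` {..k * m}) (map (blk m n a) [0..<k * m + 1])"
    using st by (simp only: is_standard_form_def)
  then have "colored_set_partition m n (blk m n a ` {..k * m})"
    using blk_partition[OF s] unfolding colored_set_partition_def by blast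
  moreover have "card (blk m n a ` {..k * m}) = k * m + 1"
    using inj_on_blk[OF s] by (simp add: card_image)
  moreover have "map (col m i) [nat (1 - a i)..<nat (1 - a i) + m] \<in> cyclic_orders m i"
    if "i \<in> {1..n}" "a i \<le> 0" for i
  proof -
    \<comment> \<open>The bounds \<open>2 - m \<le> a i \<le> 0\<close> say precisely that the
      starting exponent is admissible.\<close>
    have "nat (1 - a i) \<in> {1..m - 1}" using openingsD(4)[OF s that(1)] that(2) by auto
    then show ?thesis unfolding cyclic_orders_def by blast
  qed
  ultimately show ?thesis
    unfolding super_set_partitions_def of_word_def using zero_bases_blk by auto
qed

text \<open>The element of base \<open>i\<close> with colour 0 lies in block
  \<open>nat (a i)\<close>, which is block 0 for nonpositive letters. It is inverted with the later
  blocks of the groups opened up to \<open>i\<close>.\<close>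

lemma block_inversions_of_word:
  "card (block_inversions m n k (of_word m n k a)) = (\<Sum>i=1..n. opened m a i * m - nat (a i))"
proof -
  define Bs where "Bs = map (blk m n a) [0..<k * m + 1]"
  have nth: "Bs ! j = blk m n a j" if "j \<le> k * m" for j
    unfolding Bs_def using that by (subst nth_map) (simp_all del: upt_Suc)
  have op: "opened m a i * m \<le> k * m" if "i \<in> {1..n}" for i
    using openings_opened[OF m_pos s, of i] that by simp
  \<comment> \<open>All blocks of a group have the opening position as least base, so the comparison
    with \<open>i\<close> asks whether the group of \<open>l\<close> is open at
    \<open>i\<close>.\<close>
  have minb: "minb m (blk m n a l) \<le> i \<longleftrightarrow> l \<le> opened m a i * m"
    if i: "i \<in> {1..n}" and l: "0 < l" "l \<le> k * m" for i l
  proof -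
    obtain g r where g: "g < k" "r < m" "l = g * m + 1 + r" using l block_number_cases by blast
    have "minb m (blk m n a l) \<le> i \<longleftrightarrow> s g \<le> i" unfolding g(3) minb_blk[OF s g(1,2)] ..
    also have "\<dots> \<longleftrightarrow> g < opened m a i" using openings_opened[OF m_pos s, of i] i g(1) by simp
    also have "\<dots> \<longleftrightarrow> l \<le> opened m a i * m"
    proof
      assume "g < opened m a i"
      then show "l \<le> opened m a i * m" unfolding g(3) using g(2) by (rule block_number_le)
    next
      assume "l \<le> opened m a i * m"
      then have "g * m < opened m a i * m" using g(3) by linarith
      then show "g < opened m a i" by simp
    qed
    finally show ?thesis .
  qed
  have "block_inversions m n k (of_word m n k a) =
      (\<lambda>(i, l). (col m i 0, blk m n a l)) ` (SIGMA i:{1..n}. {nat (a i)<..opened m a i * m})"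
  proof (intro set_eqI iffI)
    fix x assume "x \<in> block_inversions m n k (of_word m n k a)"
    then obtain i j l where x: "x = (col m i 0, Bs ! l)" "i \<in> {1..n}" "j < l" "l \<le> k * m"
        "col m i 0 \<in> Bs ! j" "minb m (Bs ! l) \<le> i"
      unfolding block_inversions_def of_word_def Let_def fst_conv standard_form_blk Bs_def by blast
    have "nat (a i) = j" using x nth[of j] by (simp add: col_in_blk_iff)
    moreover have "l \<le> opened m a i * m" using minb[OF x(2) _ x(4)] x(3,6) nth[OF x(4)] by simp
    ultimately show "x \<in> (\<lambda>(i, l). (col m i 0, blk m n a l)) ` (SIGMA i:{1..n}. {nat (a i)<..opened m a i * m})"
      using x nth[OF x(4)] by (intro image_eqI[where x = "(i, l)"]) simp_all
  next
    fix x assume "x \<in> (\<lambda>(i, l). (col m i 0, blk m n a l)) ` (SIGMA i:{1..n}. {nat (a i)<..opened m a i * m})"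
    then obtain i l where x: "x = (col m i 0, blk m n a l)" "i \<in> {1..n}" "nat (a i) < l" "l \<le> opened m a i * m"
      by auto
    have l: "l \<le> k * m" by (rule order_trans[OF x(4) op[OF x(2)]])
    have "col m i 0 \<in> Bs ! nat (a i)" using x(2,3) l by (simp add: nth col_in_blk_iff)
    moreover have "minb m (Bs ! l) \<le> i" using minb[OF x(2) _ l] x(3,4) nth[OF l] by simp
    moreover have "x = (col m i 0, Bs ! l)" using x(1) nth[OF l] by simp
    ultimately show "x \<in> block_inversions m n k (of_word m n k a)"
      unfolding block_inversions_def of_word_def Let_def fst_conv standard_form_blk Bs_def[symmetric]
      using x(2,3) l by blast
  qed
  moreover have "inj_on (\<lambda>(i, l). (col m i 0, blk m n a l)) (SIGMA i:{1..n}. {nat (a i)<..opened m a i * m})"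
    using op by (auto simp: inj_on_def col_eq_iff dest!: inj_onD[OF inj_on_blk[OF s]] intro: order_trans)
  ultimately show ?thesis by (simp add: card_image)
qed

text \<open>For \<open>a i \<le> 0\<close> the colours after colour 0 are
  \<open>1, ..., -a i\<close> by \<open>order_positions\<close>; for a positive letter the summand
  is 0.\<close>

lemma order_inversions_of_word:
  "card (order_inversions m n k (of_word m n k a)) = (\<Sum>i=1..n. nat (- a i))"
proof -
  have nth0: "map (blk m n a) [0..<k * m + 1] ! 0 = blk m n a 0"
    by (subst nth_map) (simp_all del: upt_Suc)
  have *: "(\<exists>p b. p < b \<and> b < length (snd (of_word m n k a) i) \<and>
      snd (of_word m n k a) i ! p = col m i 0 \<and> snd (of_word m n k a) i ! b = col m i c) \<longleftrightarrow>
      0 < c \<and> c \<le> nat (- a i)" if i: "i \<in> {1..n}" "a i \<le> 0" and c: "c < m" for i c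
  proof -
    define c0 where "c0 = nat (1 - a i)"
    have c0: "0 < c0" "c0 < m" using openingsD(4)[OF s i(1)] i(2) by (auto simp: c0_def)
    have w: "snd (of_word m n k a) i = map (col m i) [c0..<c0 + m]"
      using i by (simp add: of_word_def c0_def)
    have "(\<exists>p b. p < b \<and> b < length (snd (of_word m n k a) i) \<and>
      snd (of_word m n k a) i ! p = col m i 0 \<and> snd (of_word m n k a) i ! b = col m i c) \<longleftrightarrow>
      (\<exists>p b. p < b \<and> b < m \<and> (c0 + p) mod m = 0 \<and> (c0 + b) mod m = c)"
      unfolding w using c by (auto simp: col_eq_iff intro!: ex_cong1)
    also have "\<dots> \<longleftrightarrow> 0 < c \<and> c < c0" by (rule order_positions[OF c0 c])
    also have "\<dots> \<longleftrightarrow> 0 < c \<and> c \<le> nat (- a i)" using i(2) by (auto simp: c0_def)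
    finally show ?thesis .
  qed
  have "order_inversions m n k (of_word m n k a) =
      (\<lambda>(i, c). (col m i 0, col m i c)) ` (SIGMA i:{1..n}. {1..nat (- a i)})"
  proof (intro set_eqI iffI)
    fix x assume "x \<in> order_inversions m n k (of_word m n k a)"
    then obtain i c where x: "x = (col m i 0, col m i c)" "i \<in> {1..n}" "c < m" "col m i 0 \<in> blk m n a 0"
      and ex: "\<exists>p b. p < b \<and> b < length (snd (of_word m n k a) i) \<and>
        snd (of_word m n k a) i ! p = col m i 0 \<and> snd (of_word m n k a) i ! b = col m i c"
      unfolding order_inversions_def Let_def of_word_def[of m n k a, THEN arg_cong[of _ _ fst], unfolded fst_conv]
        standard_form_blk nth0 by blast
    have "a i \<le> 0" using x(4) by (simp add: col_in_blk_iff)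
    then show "x \<in> (\<lambda>(i, c). (col m i 0, col m i c)) ` (SIGMA i:{1..n}. {1..nat (- a i)})"
      using *[OF x(2) _ x(3)] ex x(1,2) by (intro image_eqI[where x = "(i, c)"]) auto
  next
    fix x assume "x \<in> (\<lambda>(i, c). (col m i 0, col m i c)) ` (SIGMA i:{1..n}. {1..nat (- a i)})"
    then obtain i c where x: "x = (col m i 0, col m i c)" "i \<in> {1..n}" "1 \<le> c" "c \<le> nat (- a i)" by auto
    have ai: "a i \<le> 0" using x by linarith
    have c: "c < m" using openingsD(4)[OF s x(2)] x(3,4) by linarith
    have "col m i 0 \<in> blk m n a 0" "col m i c \<in> blk m n a 0"
      using x(2) ai by (simp_all add: col_in_blk_iff block_index_eq_0_iff)
    moreover have "\<exists>p b. p < b \<and> b < length (snd (of_word m n k a) i) \<and>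
        snd (of_word m n k a) i ! p = col m i 0 \<and> snd (of_word m n k a) i ! b = col m i c"
      using *[OF x(2) ai c] x(3,4) by simp
    ultimately show "x \<in> order_inversions m n k (of_word m n k a)"
      unfolding order_inversions_def Let_def of_word_def[of m n k a, THEN arg_cong[of _ _ fst], unfolded fst_conv]
        standard_form_blk nth0 using x(1,2) c by blast
  qed
  moreover have "inj_on (\<lambda>(i, c). (col m i 0, col m i c)) (SIGMA i:{1..n}. {1..nat (- a i)})"
  proof -
    \<comment> \<open>Colours below \<open>m\<close> are distinguished by \<open>col\<close>, so the
      pairs are counted without repetition.\<close>
    have "c < m" if "i \<in> {1..n}" "c \<in> {1..nat (- a i)}" for i c
      using openingsD(4)[OF s that(1)] that(2) by auto
    then show ?thesis by (auto simp: inj_on_def col_eq_iff)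
  qed
  ultimately show ?thesis by (simp add: card_image)
qed

text \<open>At most one of \<open>nat (a i)\<close> and \<open>nat (- a i)\<close> is nonzero, so
  the two counts merge into the single difference in \<open>weight\<close>.\<close>

lemma inversions_of_word: "inversions m n k (of_word m n k a) = weight m n a"
proof -
  have "opened m a i * m - nat (a i) + nat (- a i) = nat (int (opened m a i * m) - a i)" for i
    by linarith
  then show ?thesis
    by (simp only: inversions_def weight_def block_inversions_of_word order_inversions_of_word
        flip: sum.distrib)
qed

end

section \<open>Recovering the growth word from the super set partition\<close>

lemma inj_on_of_word: "inj_on (of_word m n k) (growth_words m n k)"
proof (rule inj_onI)
  fix a b assume "a \<in> growth_words m n k" "b \<in> growth_words m n k" and eq: "of_word m n k a = of_word m n k b"
  then obtain s s' where ext: "a \<in> extensional {1..n}" "b \<in> extensional {1..n}"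
    and s: "openings m n k a s" and s': "openings m n k b s'"
    using growth_words_iff[OF m_pos] by blast
  have "blk m n a ` {..k * m} = blk m n b ` {..k * m}" using eq by (simp add: of_word_def)
  \<comment> \<open>Equal sets of blocks have the same standard form, so the blocks agree label by
    label.\<close>
  then have "map (blk m n a) [0..<k * m + 1] = map (blk m n b) [0..<k * m + 1]"
    using standard_form_blk[OF s] standard_form_blk[OF s'] by metis
  then have blk: "blk m n a j = blk m n b j" if "j \<le> k * m" for j
    using that by (simp del: upt_Suc)
  show "a = b"
  proof (rule extensionalityI[OF ext])
    fix i assume i: "i \<in> {1..n}"
    have "nat (a i) \<le> k * m" using openingsD(5)[OF s i] by linarith
    moreover have "col m i 0 \<in> blk m n a (nat (a i))" using i by (simp add: col_in_blk_iff)
    ultimately have nat: "nat (b i) = nat (a i)" using blk by (simp add: col_in_blk_iff)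
    show "a i = b i"
    proof (cases "a i \<le> 0")
      case True
      then have b: "b i \<le> 0" using nat by linarith
      \<comment> \<open>In the zero block the letter is read off from the first element of the
        ordering, whose exponent lies below \<open>m\<close>.\<close>
      have "snd (of_word m n k a) i ! 0 = snd (of_word m n k b) i ! 0" by (simp only: eq)
      then have "col m i (nat (1 - a i)) = col m i (nat (1 - b i))"
        using i True b m_pos by (simp add: of_word_def)
      moreover have "nat (1 - a i) < m" "nat (1 - b i) < m"
        using openingsD(4)[OF s i] openingsD(4)[OF s' i] True b by linarith+
      ultimately have "nat (1 - a i) = nat (1 - b i)" by (simp add: col_eq_iff)
      then show ?thesis using True b by linarith
    next
      case False
      then show ?thesis using nat by linarith
    qed
  qed
qed

text \<open>The word is read off from the standard form and the orderings; the least bases of the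
  groups then serve as its opening positions.\<close>

lemma of_word_surj:
  assumes "(P, w) \<in> super_set_partitions m n k"
  shows "(P, w) \<in> of_word m n k ` growth_words m n k"
proof -
  have P: "partition_on (colored_numbers m n) P" and card: "card P = k * m + 1"
    and w: "w \<in> (\<Pi>\<^sub>E i\<in>zero_bases m n P. cyclic_orders m i)"
    using assms by (auto simp: super_set_partitions_def colored_set_partition_def)
  obtain k' Bs' where lab': "block_labelling m n k' P Bs'"
    using assms by (auto simp: super_set_partitions_def colored_set_partition_def)
  \<comment> \<open>The number of groups is only asserted to exist in
    \<open>colored_set_partition\<close>; the cardinality of \<open>P\<close> fixes it.\<close>
  have "k' * m + 1 = k * m + 1"
    using lab' card unfolding block_labelling_def by (metis distinct_card)
  then have "k' = k" using m_pos by simp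
  then obtain Bs where st: "is_standard_form m n k P Bs"
    using standard_form_exists[OF P] lab' by blast
  then have lab: "block_labelling m n k P Bs" by (simp add: is_standard_form_def)
  note disjoint = labelling_disjoint[OF P lab]
  have set_Bs: "set Bs = P" and len: "length Bs = k * m + 1"
    using lab by (simp_all add: block_labelling_def)
  have "\<exists>j\<le>k * m. col m i 0 \<in> Bs ! j" if "i \<in> {1..n}" for i
  proof -
    have "col m i 0 \<in> colored_numbers m n" using that m_pos by (auto simp: colored_numbers_def)
    then obtain B where "B \<in> P" "col m i 0 \<in> B" using P by (auto simp: partition_on_def)
    then show ?thesis using labelling_obtain[OF P lab] by metis
  qed
  then obtain J where J: "\<And>i. i \<in> {1..n} \<Longrightarrow> J i \<le> k * m" "\<And>i. i \<in> {1..n} \<Longrightarrow> col m i 0 \<in> Bs ! J i"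
    by metis
  have zb: "zero_block P = Bs ! 0"
    by (rule zero_block_eq[OF P labelling_in[OF P lab]]) (use lab in \<open>simp_all add: block_labelling_def\<close>)
  have Bs_0: "col m i c \<in> Bs ! 0" if "i \<in> {1..n}" "J i = 0" for i c
  proof -
    have "\<forall>i\<in>{1..n}. (\<exists>c<m. col m i c \<in> Bs ! 0) \<longrightarrow> (\<forall>d<m. col m i d \<in> Bs ! 0)"
      using lab unfolding block_labelling_def by (elim conjE)
    moreover have "col m i 0 \<in> Bs ! 0" using J(2)[OF that(1)] that(2) by simp
    ultimately have "\<forall>d<m. col m i d \<in> Bs ! 0" using that(1) m_pos by metis
    then show ?thesis using m_pos by (metis col_mod mod_less_divisor)
  qed
  have zero: "zero_bases m n P = {i \<in> {1..n}. J i = 0}"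
  proof -
    have "(\<forall>c<m. col m i c \<in> Bs ! 0) \<longleftrightarrow> J i = 0" if "i \<in> {1..n}" for i
      using Bs_0[OF that] disjoint[OF J(1)[OF that] _ J(2)[OF that], of 0] m_pos by auto
    then show ?thesis unfolding zero_bases_def zb by auto
  qed
  have "\<exists>c. c \<in> {1..m - 1} \<and> w i = map (col m i) [c..<c + m]" if "i \<in> {1..n}" "J i = 0" for i
    using PiE_mem[OF w, of i] that unfolding zero cyclic_orders_def by blast
  then obtain C where C: "\<And>i. i \<in> {1..n} \<Longrightarrow> J i = 0 \<Longrightarrow> C i \<in> {1..m - 1}"
      "\<And>i. i \<in> {1..n} \<Longrightarrow> J i = 0 \<Longrightarrow> w i = map (col m i) [C i..<C i + m]"
    by metis
  define a where "a = (\<lambda>i. if i \<in> {1..n} then if J i = 0 then 1 - int (C i) else int (J i) else undefined)"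
  have a: "a i = int (J i)" if "i \<in> {1..n}" "J i \<noteq> 0" for i using that by (simp add: a_def)
  have a0: "a i = 1 - int (C i)" if "i \<in> {1..n}" "J i = 0" for i using that by (simp add: a_def)
  have a_le0: "a i \<le> 0 \<longleftrightarrow> J i = 0" if "i \<in> {1..n}" for i
    using a[OF that] a0[OF that] C(1)[OF that] by (cases "J i = 0") auto
  have a_bounds: "2 - int m \<le> a i" "a i \<le> int (k * m)" if i: "i \<in> {1..n}" for i
  proof -
    have "2 - int m \<le> a i \<and> a i \<le> int (k * m)"
    proof (cases "J i = 0")
      case True
      then show ?thesis using C(1)[OF i True] a0[OF i True] by (auto simp: of_nat_diff simp del: of_nat_mult)
    next
      case False
      then have "a i = int (J i)" by (rule a[OF i])
      then show ?thesis using J(1)[OF i] False m_pos by linarith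
    qed
    then show "2 - int m \<le> a i" "a i \<le> int (k * m)" by blast+
  qed
  \<comment> \<open>Rotating the block of colour 0 by \<open>c\<close> gives the block of colour
    \<open>c\<close>, with the label computed by \<open>block_index\<close>.\<close>
  have in_Bs: "col m i c \<in> Bs ! block_index m (a i) c" if i: "i \<in> {1..n}" for i c
  proof (cases "J i = 0")
    case True
    then have "block_index m (a i) c = 0" using a_le0[OF i] by (simp add: block_index_eq_0_iff)
    then show ?thesis using Bs_0[OF i True] by simp
  next
    case False
    then obtain l r where lr: "l < k" "r < m" "J i = l * m + 1 + r"
      using J(1)[OF i] block_number_cases by blast
    have "col m i (0 + c) \<in> scale (zeta m ^ c) (Bs ! J i)"
      using J(2)[OF i] by (simp only: col_in_scale)
    also have "scale (zeta m ^ c) (Bs ! J i) = Bs ! (l * m + 1 + (r + c) mod m)"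
      unfolding lr(3) by (rule labelling_scale[OF P lab lr(1,2)])
    also have "l * m + 1 + (r + c) mod m = block_index m (a i) c"
    proof -
      have "nat (a i) - 1 = l * m + r" "\<not> a i \<le> 0" using a[OF i False] lr(3) by linarith+
      moreover have "(l * m + r) div m = l" using lr(2) by simp
      moreover have "(l * m + r + c) mod m = (r + c) mod m" by (metis add.assoc mod_mult_self3)
      ultimately show ?thesis unfolding block_index_def by simp
    qed
    finally show ?thesis by simp
  qed
  have blk_Bs: "blk m n a j = Bs ! j" if j: "j \<le> k * m" for j
  proof (intro set_eqI iffI)
    fix x assume "x \<in> blk m n a j"
    then show "x \<in> Bs ! j"
      by (cases rule: blk_cases) (use in_Bs lab in \<open>auto simp: block_labelling_def\<close>)
  next
    fix x assume x: "x \<in> Bs ! j"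
    then have "x \<in> colored_numbers m n" by (rule labelling_col[OF P lab _ j])
    then consider "x = zvec" | i c where "x = col m i c" "i \<in> {1..n}"
      by (auto simp: colored_numbers_def)
    then show "x \<in> blk m n a j"
    proof cases
      case 1
      then show ?thesis using x zvec_in_labelling[OF P lab j] by (simp add: zvec_in_blk_iff)
    next
      case 2
      have "block_index m (a i) c = j"
        using disjoint[OF block_index_le[OF a_bounds(2)[OF 2(2)]] j] in_Bs[OF 2(2)] x 2(1) by blast
      then show ?thesis using 2 by (simp add: col_in_blk_iff)
    qed
  qed
  define t where "t l = minb m (Bs ! (Suc l * m))" for l
  have bound: "0 < Suc l * m" "Suc l * m \<le> k * m" if "l < k" for l
    using mult_le_mono1[of "Suc l" k m] that m_pos by simp_all
  have mono: "t l < t l'" if "l < l'" "l' < k" for l l'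
    using sorted_wrt_nth_less[OF standard_form_sorted[OF st], of l l'] that by (simp add: t_def)
  have "openings m n k a t"
    unfolding openings_def
  proof (intro conjI ballI allI impI)
    show "strict_mono_on {..<k} t" by (rule strict_mono_onI) (use mono in auto)
    show tn: "t l \<in> {1..n}" if "l < k" for l
      unfolding t_def by (rule labelling_minb_props(2)[OF P lab bound[OF that]])
    show "a (t l) = int (Suc l * m)" if l: "l < k" for l
    proof -
      \<comment> \<open>The last label of a group is 0 modulo \<open>m\<close>, so the standard form
        puts colour 0 of the least base there, which makes that label its letter.\<close>
      have "Suc l * m \<in> {1..k * m}"
        using bound[OF l] unfolding atLeastAtMost_iff One_nat_def Suc_le_eq by blast
      then have "col m (minb m (Bs ! (Suc l * m))) ((Suc l * m) mod m) \<in> Bs ! (Suc l * m)"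
        using st unfolding is_standard_form_def by blast
      then have "col m (t l) 0 \<in> Bs ! (Suc l * m)"
        unfolding t_def mod_mult_self2_is_0 .
      then have "J (t l) = Suc l * m"
        using disjoint[OF J(1)[OF tn[OF l]] bound(2)[OF l] J(2)[OF tn[OF l]]] by blast
      then show ?thesis using a[OF tn[OF l]] bound(1)[OF l] by simp
    qed
    show "2 - int m \<le> a i" "a i \<le> int (k * m)" if "i \<in> {1..n}" for i
      using a_bounds[OF that] by blast+
    fix i l assume i: "i \<in> {1..n}" and l: "l < k" "int (l * m) < a i"
    have J0: "J i \<noteq> 0" using a_le0[OF i] l(2) by (metis of_nat_0_le_iff less_le_trans not_less order_less_imp_le)
    \<comment> \<open>Base \<open>i\<close> occurs in group \<open>g\<close>, hence
      \<open>t g \<le> i\<close>; a letter above \<open>l * m\<close> gives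
      \<open>l \<le> g\<close>, and \<open>t\<close> is increasing.\<close>
    then obtain g r where g: "g < k" "r < m" "J i = g * m + 1 + r"
      using J(1)[OF i] block_number_cases by blast
    have "l * m < J i" using l(2) unfolding a[OF i J0] of_nat_less_iff .
    then have "l * m < Suc g * m" using g m_pos by simp
    then have "l \<le> g" by (metis less_Suc_eq_le mult_less_cancel2)
    moreover have "t g \<le> i"
      using labelling_minb_props(3)[OF P lab _ J(1)[OF i] J(2)[OF i]] J0 labelling_minb[OF P lab g(1,2)]
      unfolding t_def g(3) by simp
    ultimately show "t l \<le> i" using mono[of l g] g(1) by (cases "l = g") auto
  qed
  then have "a \<in> growth_words m n k"
    using growth_words_iff[OF m_pos] by (auto simp: a_def extensional_def)
  moreover have "(P, w) = of_word m n k a"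
  proof -
    have blocks: "blk m n a ` {..k * m} = P"
    proof -
      have "blk m n a ` {..k * m} = (!) Bs ` {..<length Bs}"
        using blk_Bs len by (intro image_cong) auto
      then show ?thesis using set_Bs by (simp add: set_conv_nth image_def lessThan_def) blast
    qed
    have orders: "w i = (if i \<in> {1..n} \<and> a i \<le> 0 then map (col m i) [nat (1 - a i)..<nat (1 - a i) + m] else undefined)" for i
    proof (cases "i \<in> zero_bases m n P")
      case True
      then show ?thesis using C(2)[of i] a0[of i] a_le0[of i] unfolding zero by simp
    next
      case False
      then show ?thesis using PiE_arb[OF w False] a_le0[of i] unfolding zero by auto
    qed
    show ?thesis
      unfolding of_word_def blocks by (rule arg_cong[where f = "Pair P"], rule ext, rule orders)
  qed
  ultimately show ?thesis by (metis imageI)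
qed

lemma super_set_partitions_eq: "super_set_partitions m n k = of_word m n k ` growth_words m n k"
proof
  show "super_set_partitions m n k \<subseteq> of_word m n k ` growth_words m n k"
    using of_word_surj by (rule subrelI)
  show "of_word m n k ` growth_words m n k \<subseteq> super_set_partitions m n k"
    using of_word_in growth_words_iff[OF m_pos] by blast
qed

end

theorem theorem4p3:
  fixes m n k :: nat
  assumes "m \<ge> 1"
  shows "superS m n k = (\<Sum>\<sigma>\<in>super_set_partitions m n k. q ^ inversions m n k \<sigma>)"
proof -
  interpret modulus m by unfold_locales (use assms in simp)
  have "inversions m n k (of_word m n k a) = weight m n a" if "a \<in> growth_words m n k" for a
    using that inversions_of_word growth_words_iff[OF m_pos] by blast
  then show ?thesis
    by (simp add: superS_growth_words[OF m_pos] super_set_partitions_eq sum.reindex[OF inj_on_of_word])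
qed

end
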